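(* Let $F\in\mathcal{F}$, with expansion $F(Z)=Z+\sum_{n=2}^{\infty}A_nZ^n$ on $\mathbb{D}_{\mathbb{BC}}$, $A_n\in\mathbb{BC}$. Then $|A_2|_{\mathbf{k}}\preceq 2$, with equality $|A_2|_{\mathbf{k}}=2$ if and only if $F$ is a rotation of the $\mathbb{BC}$-Koebe function.
   Context: Bicomplex numbers: $\mathbb{BC}=\{Z_1+\mathbf{j}Z_2: Z_1,Z_2\in\mathbb{C}(\mathbf{i})\}$, where $\mathbf{i}\neq\mathbf{j}$, $\mathbf{i}\mathbf{j}=\mathbf{j}\mathbf{i}=\mathbf{k}$, $\mathbf{i}^2=\mathbf{j}^2=-1$, and $\mathbb{C}(\mathbf{i})$ is the complex field with imaginary unit $\mathbf{i}$. Put $\mathbf{e_1}=\frac12(1+\mathbf{k})$, $\mathbf{e_2}=\frac12(1-\mathbf{k})$; these satisfy $\mathbf{e_1}+\mathbf{e_2}=1$, $\mathbf{e_1}\mathbf{e_2}=0$, $\mathbf{e_l}^2=\mathbf{e_l}$. Every $Z=Z_1+\mathbf{j}Z_2$ is written uniquely as $Z=\beta_1\mathbf{e_1}+\beta_2\mathbf{e_2}$ with $\beta_1=Z_1-\mathbf{i}Z_2$, $\beta_2=Z_1+\mathbf{i}Z_2$ in $\mathbb{C}(\mathbf{i})$; operations are componentwise in this representation. $\mathcal{O}_0=\mathcal{O}\cup\{0\}$, where $\mathcal{O}=\{Z=Z_1+\mathbf{j}Z_2\ne0: Z_1^2+Z_2^2=0\}$ is the set of zero divisors, so $Z\in\mathcal{O}_0$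 iff $\beta_1=0$ or $\beta_2=0$. The hyperbolic-valued norm is $|Z|_{\mathbf{k}}=|\beta_1|\mathbf{e_1}+|\beta_2|\mathbf{e_2}$. For $a=a_1\mathbf{e_1}+a_2\mathbf{e_2}$, $b=b_1\mathbf{e_1}+b_2\mathbf{e_2}$ with real $a_l,b_l$, $a\preceq b$ means $a_1\le b_1$ and $a_2\le b_2$; real numbers $c$ are identified with $c\,\mathbf{e_1}+c\,\mathbf{e_2}$. A set $\Omega\subset\mathbb{BC}$ is product-type if $\Omega=\Omega_1\mathbf{e_1}+\Omega_2\mathbf{e_2}$ with $\Omega_1,\Omega_2\subset\mathbb{C}(\mathbf{i})$. A function $F:\Omega\to\mathbb{BC}$ is product-type if there are $F_l:\Omega_l\to\mathbb{C}(\mathbf{i})$ with $F(\beta_1\mathbf{e_1}+\beta_2\mathbf{e_2})=F_1(\beta_1)\mathbf{e_1}+F_2(\beta_2)\mathbf{e_2}$ on $\Omega$. $F$ is $\mathbb{BC}$-holomorphic on an open set $\Omega$ if for every $Z_0\in\Omega$ the limit $F'(Z_0)$ of $\frac{F(Z)-F(Z_0)}{Z-Z_0}$ as $Z\to Z_0$ with $Z-Z_0\notin\mathcal{O}_0$ exists. $F$ is $\mathbb{BC}$-univalent on a product-type open set $\Omega$ if $F$ is product-type and $F(Z)\ne F(W)$ for all distinct $Z,W\in\Omega$. The bicomplex unit disk is $\mathbb{D}_{\mathbb{BC}}=\{\beta_1\mathbf{e_1}+\beta_2\mathbf{e_2}:|\beta_1|<1,\ |\beta_2|<1\}$. $\mathcal{F}$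 is the set of functions $F:\mathbb{D}_{\mathbb{BC}}\to\mathbb{BC}$ that are $\mathbb{BC}$-holomorphic and $\mathbb{BC}$-univalent on $\mathbb{D}_{\mathbb{BC}}$ with $F(0)=0$ and $F'(0)=1$. The rotations of the $\mathbb{BC}$-Koebe function are the functions $Z\mapsto\frac{Z}{(1+BZ)^2}$ on $\mathbb{D}_{\mathbb{BC}}$ with $B\in\mathbb{BC}$, $|B|_{\mathbf{k}}=1$ (the $\mathbb{BC}$-Koebe function itself is $Z\mapsto\frac{Z}{(1-Z)^2}$). *)

theory Defs
  imports "HOL-Analysis.Analysis"
begin

section \<open>The ring of bicomplex numbers\<close>

text \<open>\<open>Bicomplex Z1 Z2\<close> stands for \<open>Z1 + j Z2\<close>.\<close>

datatype bicomplex = Bicomplex (cpt1: complex) (cpt2: complex)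

lemma bicomplex_eq_iff: "Z = W \<longleftrightarrow> cpt1 Z = cpt1 W \<and> cpt2 Z = cpt2 W"
  by (cases Z; cases W) auto

instantiation bicomplex :: comm_ring_1
begin

definition "0 = Bicomplex 0 0"
definition "1 = Bicomplex 1 0"
definition "Z + W = Bicomplex (cpt1 Z + cpt1 W) (cpt2 Z + cpt2 W)"
definition "Z - W = Bicomplex (cpt1 Z - cpt1 W) (cpt2 Z - cpt2 W)"
definition "- Z = Bicomplex (- cpt1 Z) (- cpt2 Z)"
definition "Z * W = Bicomplex (cpt1 Z * cpt1 W - cpt2 Z * cpt2 W) (cpt1 Z * cpt2 W + cpt2 Z * cpt1 W)"

instance
  by standard
    (auto simp: bicomplex_eq_iff zero_bicomplex_def one_bicomplex_def plus_bicomplex_def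
      minus_bicomplex_def uminus_bicomplex_def times_bicomplex_def algebra_simps)

end

lemma cpt_simps [simp]:
  "cpt1 0 = 0" "cpt2 0 = 0" "cpt1 1 = 1" "cpt2 1 = 0"
  "cpt1 (Z + W) = cpt1 Z + cpt1 W" "cpt2 (Z + W) = cpt2 Z + cpt2 W"
  "cpt1 (Z - W) = cpt1 Z - cpt1 W" "cpt2 (Z - W) = cpt2 Z - cpt2 W"
  "cpt1 (- Z) = - cpt1 Z" "cpt2 (- Z) = - cpt2 Z"
  "cpt1 (Z * W) = cpt1 Z * cpt1 W - cpt2 Z * cpt2 W"
  "cpt2 (Z * W) = cpt1 Z * cpt2 W + cpt2 Z * cpt1 W"
  by (simp_all add: zero_bicomplex_def one_bicomplex_def plus_bicomplex_def
      minus_bicomplex_def uminus_bicomplex_def times_bicomplex_def)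

instantiation bicomplex :: real_vector
begin

definition "r *\<^sub>R Z = Bicomplex (r *\<^sub>R cpt1 Z) (r *\<^sub>R cpt2 Z)"

instance
  by standard (auto simp: bicomplex_eq_iff scaleR_bicomplex_def algebra_simps)

end

lemma cpt_scaleR [simp]:
  "cpt1 (r *\<^sub>R Z) = r *\<^sub>R cpt1 Z" "cpt2 (r *\<^sub>R Z) = r *\<^sub>R cpt2 Z"
  by (simp_all add: scaleR_bicomplex_def)

instance bicomplex :: real_algebra_1
  by standard (auto simp: bicomplex_eq_iff algebra_simps)

lemma cpt_of_real [simp]: "cpt1 (of_real r) = of_real r" "cpt2 (of_real r) = 0"
  by (simp_all add: of_real_def)

text \<open>The topology is that of the Euclidean norm \<open>sqrt (|Z1|^2 + |Z2|^2)\<close>. This norm is not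
  submultiplicative, so the type is not an instance of \<^class>\<open>real_normed_algebra\<close>.\<close>

instantiation bicomplex :: real_normed_vector
begin

definition "norm Z = sqrt ((cmod (cpt1 Z))\<^sup>2 + (cmod (cpt2 Z))\<^sup>2)"
definition "sgn (Z :: bicomplex) = Z /\<^sub>R norm Z"
definition "dist Z W = norm (Z - W :: bicomplex)"
definition "uniformity = (INF e\<in>{0 <..}. principal {(Z, W :: bicomplex). dist Z W < e})"
definition "open (U :: bicomplex set) \<longleftrightarrow> (\<forall>Z\<in>U. eventually (\<lambda>(Z', W). Z' = Z \<longrightarrow> W \<in> U) uniformity)"

lemma norm_bicomplex_prod: "norm Z = norm (cpt1 Z, cpt2 Z)"
  by (simp add: norm_bicomplex_def norm_prod_def)

instance
proof
  fix Z W :: bicomplex and r s :: real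
  show "(norm Z = 0) = (Z = 0)"
    by (auto simp: norm_bicomplex_prod bicomplex_eq_iff zero_prod_def)
  show "norm (Z + W) \<le> norm Z + norm W"
    using norm_triangle_ineq[of "(cpt1 Z, cpt2 Z)" "(cpt1 W, cpt2 W)"]
    by (simp add: norm_bicomplex_prod)
  show "norm (r *\<^sub>R Z) = \<bar>r\<bar> * norm Z"
    using norm_scaleR[of r "(cpt1 Z, cpt2 Z)"]
    by (simp add: norm_bicomplex_prod scaleR_bicomplex_def)
qed (auto simp: bicomplex_eq_iff scaleR_bicomplex_def dist_bicomplex_def sgn_bicomplex_def
      uniformity_bicomplex_def open_bicomplex_def algebra_simps)

end

text \<open>The inverse is \<open>(Z1 - j Z2) / (Z1^2 + Z2^2)\<close>; it takes the value \<open>0\<close> if \<open>Z1^2 + Z2^2 = 0\<close>.\<close>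

instantiation bicomplex :: inverse
begin

definition "inverse Z = Bicomplex (cpt1 Z / ((cpt1 Z)\<^sup>2 + (cpt2 Z)\<^sup>2)) (- cpt2 Z / ((cpt1 Z)\<^sup>2 + (cpt2 Z)\<^sup>2))"
definition "Z div W = Z * inverse (W :: bicomplex)"

instance ..

end

definition bc_zero_divisors :: "bicomplex set" where
  "bc_zero_divisors = {Z. Z \<noteq> 0 \<and> (cpt1 Z)\<^sup>2 + (cpt2 Z)\<^sup>2 = 0}"

definition bc_zero_divisors0 :: "bicomplex set" where
  "bc_zero_divisors0 = bc_zero_divisors \<union> {0}"

lemma bc_right_inverse:
  assumes "Z \<notin> bc_zero_divisors0"
  shows "Z * inverse Z = 1"
proof -
  have "(cpt1 Z)\<^sup>2 + (cpt2 Z)\<^sup>2 \<noteq> 0"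
    using assms by (auto simp: bc_zero_divisors0_def bc_zero_divisors_def)
  then show ?thesis
    by (simp add: bicomplex_eq_iff inverse_bicomplex_def power2_eq_square
        flip: add_divide_distrib)
qed


section \<open>Idempotent representation\<close>

definition bc_of_complex :: "complex \<Rightarrow> bicomplex" where
  "bc_of_complex z = Bicomplex z 0"

definition bc_i :: bicomplex where "bc_i = bc_of_complex \<i>"
definition bc_j :: bicomplex where "bc_j = Bicomplex 0 1"
definition bc_k :: bicomplex where "bc_k = bc_i * bc_j"

definition bc_e1 :: bicomplex where "bc_e1 = (1/2) *\<^sub>R (1 + bc_k)"
definition bc_e2 :: bicomplex where "bc_e2 = (1/2) *\<^sub>R (1 - bc_k)"

definition bc_idem :: "complex \<Rightarrow> complex \<Rightarrow> bicomplex" where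
  "bc_idem b1 b2 = bc_of_complex b1 * bc_e1 + bc_of_complex b2 * bc_e2"

definition bc_beta1 :: "bicomplex \<Rightarrow> complex" where
  "bc_beta1 Z = cpt1 Z - \<i> * cpt2 Z"

definition bc_beta2 :: "bicomplex \<Rightarrow> complex" where
  "bc_beta2 Z = cpt1 Z + \<i> * cpt2 Z"

lemma bc_units: "bc_i * bc_i = -1" "bc_j * bc_j = -1" "bc_j * bc_i = bc_k"
  by (simp_all add: bicomplex_eq_iff bc_i_def bc_j_def bc_k_def bc_of_complex_def)

lemma bc_of_complex_cpt: "Z = bc_of_complex (cpt1 Z) + bc_j * bc_of_complex (cpt2 Z)"
  by (simp add: bicomplex_eq_iff bc_j_def bc_of_complex_def)

lemma bc_e1_e2: "bc_e1 + bc_e2 = 1" "bc_e1 * bc_e2 = 0" "bc_e1 * bc_e1 = bc_e1" "bc_e2 * bc_e2 = bc_e2"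
  by (simp_all add: bicomplex_eq_iff bc_e1_def bc_e2_def bc_k_def bc_i_def bc_j_def bc_of_complex_def
      scaleR_conv_of_real)

lemma cpt_bc_idem:
  "cpt1 (bc_idem b1 b2) = (b1 + b2) / 2" "cpt2 (bc_idem b1 b2) = \<i> * (b1 - b2) / 2"
  by (simp_all add: bc_idem_def bc_e1_def bc_e2_def bc_k_def bc_i_def bc_j_def bc_of_complex_def
      scaleR_conv_of_real field_simps)

lemma bc_beta_idem [simp]: "bc_beta1 (bc_idem b1 b2) = b1" "bc_beta2 (bc_idem b1 b2) = b2"
  by (simp_all add: bc_beta1_def bc_beta2_def cpt_bc_idem field_simps)

lemma bc_idem_beta [simp]: "bc_idem (bc_beta1 Z) (bc_beta2 Z) = Z"
  by (simp add: bicomplex_eq_iff cpt_bc_idem bc_beta1_def bc_beta2_def)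

lemma bc_zero_divisors0_iff: "Z \<in> bc_zero_divisors0 \<longleftrightarrow> bc_beta1 Z = 0 \<or> bc_beta2 Z = 0"
proof -
  have "bc_beta1 Z * bc_beta2 Z = (cpt1 Z)\<^sup>2 + (cpt2 Z)\<^sup>2"
    by (simp add: bc_beta1_def bc_beta2_def algebra_simps power2_eq_square)
  moreover have "Z = 0 \<Longrightarrow> bc_beta1 Z = 0"
    by (simp add: bc_beta1_def)
  ultimately show ?thesis
    unfolding bc_zero_divisors0_def bc_zero_divisors_def by (auto simp flip: mult_eq_0_iff)
qed


section \<open>Hyperbolic-valued norm and order\<close>

definition bc_hnorm :: "bicomplex \<Rightarrow> bicomplex" where
  "bc_hnorm Z = bc_idem (of_real (cmod (bc_beta1 Z))) (of_real (cmod (bc_beta2 Z)))"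

definition hyp_le :: "bicomplex \<Rightarrow> bicomplex \<Rightarrow> bool" where
  "hyp_le a b \<longleftrightarrow> (\<exists>a1 a2 b1 b2 :: real.
     a = bc_idem (of_real a1) (of_real a2) \<and> b = bc_idem (of_real b1) (of_real b2) \<and>
     a1 \<le> b1 \<and> a2 \<le> b2)"

lemma of_real_bc_idem: "of_real c = bc_idem (of_real c) (of_real c)"
  by (simp add: bicomplex_eq_iff cpt_bc_idem)


section \<open>Holomorphic and univalent bicomplex functions\<close>

text \<open>Functions on \<open>\<Omega>\<close> are represented by total functions; no condition below looks at
  values outside \<open>\<Omega>\<close>.\<close>

definition bc_product_set :: "complex set \<Rightarrow> complex set \<Rightarrow> bicomplex set" where
  "bc_product_set \<Omega>1 \<Omega>2 = {bc_idem b1 b2 | b1 b2. b1 \<in> \<Omega>1 \<and> b2 \<in> \<Omega>2}"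

definition bc_product_type_fun :: "bicomplex set \<Rightarrow> (bicomplex \<Rightarrow> bicomplex) \<Rightarrow> bool" where
  "bc_product_type_fun \<Omega> F \<longleftrightarrow> (\<exists>\<Omega>1 \<Omega>2. \<Omega> = bc_product_set \<Omega>1 \<Omega>2 \<and>
     (\<exists>F1 F2 :: complex \<Rightarrow> complex. \<forall>b1\<in>\<Omega>1. \<forall>b2\<in>\<Omega>2. F (bc_idem b1 b2) = bc_idem (F1 b1) (F2 b2)))"

definition has_bc_derivative_on ::
    "(bicomplex \<Rightarrow> bicomplex) \<Rightarrow> bicomplex \<Rightarrow> bicomplex \<Rightarrow> bicomplex set \<Rightarrow> bool" where
  "has_bc_derivative_on F D Z0 \<Omega> \<longleftrightarrow>
     ((\<lambda>Z. (F Z - F Z0) / (Z - Z0)) \<longlongrightarrow> D) (at Z0 within {Z \<in> \<Omega>. Z - Z0 \<notin> bc_zero_divisors0})"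

definition bc_holomorphic_on :: "(bicomplex \<Rightarrow> bicomplex) \<Rightarrow> bicomplex set \<Rightarrow> bool" where
  "bc_holomorphic_on F \<Omega> \<longleftrightarrow> open \<Omega> \<and> (\<forall>Z0\<in>\<Omega>. \<exists>D. has_bc_derivative_on F D Z0 \<Omega>)"

definition bc_univalent_on :: "(bicomplex \<Rightarrow> bicomplex) \<Rightarrow> bicomplex set \<Rightarrow> bool" where
  "bc_univalent_on F \<Omega> \<longleftrightarrow> open \<Omega> \<and> bc_product_type_fun \<Omega> F \<and> (\<forall>Z\<in>\<Omega>. \<forall>W\<in>\<Omega>. Z \<noteq> W \<longrightarrow> F Z \<noteq> F W)"

definition bc_disk :: "bicomplex set" where
  "bc_disk = {bc_idem b1 b2 | b1 b2. cmod b1 < 1 \<and> cmod b2 < 1}"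

lemma bc_disk_product: "bc_disk = bc_product_set (ball 0 1) (ball 0 1)"
  by (auto simp: bc_disk_def bc_product_set_def)

lemma open_bc_disk: "open bc_disk"
proof -
  have "cmod (cpt1 Z) \<le> norm Z * 1" "cmod (cpt2 Z) \<le> norm Z * 1" for Z
    by (simp_all add: norm_bicomplex_def)
  then have lin: "bounded_linear cpt1" "bounded_linear cpt2"
    by (auto intro!: bounded_linear_intro[where K = 1])
  have eq: "bc_disk = {Z. cmod (bc_beta1 Z) < 1} \<inter> {Z. cmod (bc_beta2 Z) < 1}"
    by (auto simp: bc_disk_def) (metis bc_idem_beta)
  have "continuous_on UNIV cpt1" "continuous_on UNIV cpt2"
    using lin by (auto intro: linear_continuous_on)
  then show ?thesis
    unfolding eq bc_beta1_def bc_beta2_def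
    by (intro open_Int open_Collect_less continuous_intros) auto
qed

definition bc_class_F :: "(bicomplex \<Rightarrow> bicomplex) set" where
  "bc_class_F = {F. bc_holomorphic_on F bc_disk \<and> bc_univalent_on F bc_disk \<and>
     F 0 = 0 \<and> has_bc_derivative_on F 1 0 bc_disk}"

definition bc_koebe_rotation :: "(bicomplex \<Rightarrow> bicomplex) \<Rightarrow> bool" where
  "bc_koebe_rotation F \<longleftrightarrow> (\<exists>B. bc_hnorm B = 1 \<and> (\<forall>Z\<in>bc_disk. F Z = Z / (1 + B * Z)\<^sup>2))"

end

theory Submission
  imports Defs "HOL-Complex_Analysis.Complex_Analysis"
begin

text \<open>In the idempotent representation everything splits into two independent complex problems. A
  bicomplex univalent function on \<^term>\<open>bc_disk\<close> has two components, each injective on the complex unit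
  disk; its power series splits into the power series of the components; the hyperbolic norm records
  the two absolute values of a coefficient; and a function is a rotation of the bicomplex Koebe
  function exactly when both components are rotations of the classical one. The statement is thus
  Bieberbach's theorem on the second coefficient, applied twice
  (\<open>bieberbach_series\<close>, \<open>bc_univalent_components\<close>, \<open>bc_koebe_rotation_iff_components\<close>).

  Bieberbach's theorem (\<open>bieberbach\<close>) comes from the area theorem (\<open>area_theorem\<close>) through the square
  root transform. The area theorem says that \<open>cmod (deriv h 0) \<le> 1\<close> if \<open>\<phi> z = 1/z + h z\<close> is injective
  on the punctured unit disk. The usual argument computes the area enclosed by the image of a circle
  with Green's theorem. The proof below uses neither boundary integrals nor the topology of plane
  curves. It compares two expressions for the area of the image of an annulus \<open>s \<le> cmod z \<le> t\<close>. On
  one side, the change of variables formula and the orthogonality of Laurent monomials give, with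
  \<open>b = deriv h 0\<close>, at least \<open>\<pi> (1/s\<^sup>2 - 1/t\<^sup>2 + (cmod b)\<^sup>2 (t\<^sup>2 - s\<^sup>2))\<close>
  (\<open>has_integral_laurent_deriv_square\<close>). On the other side, the image lies in a slightly enlarged
  ellipse of area \<open>\<pi> / s\<^sup>2 + O(s)\<close>; to see this, the ellipse is straightened to a disk by a
  real-linear map (\<open>nearly_circular_image\<close>). Letting \<open>s\<close> tend to 0 and then \<open>t\<close> tend to 1 gives
  \<open>(cmod b)\<^sup>2 \<le> 1\<close>, and in the case of equality there is no area left for the higher terms of
  \<open>h\<close> (\<open>area_inequality\<close>).\<close>


section \<open>Areas of images of plane sets\<close>

text \<open>The change of variables theorems concern \<^typ>\<open>real^'n\<close>, so areas are computed in
  \<^typ>\<open>real^2\<close>. This type is identified with the complex plane through the following two mutually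
  inverse linear isometries.\<close>

definition cplx :: "real^2 \<Rightarrow> complex" where
  "cplx v = Complex (v $ 1) (v $ 2)"

definition plane :: "complex \<Rightarrow> real^2" where
  "plane z = vector [Re z, Im z]"

lemma cplx_plane [simp]: "cplx (plane z) = z"
  by (simp add: cplx_def plane_def)

lemma plane_cplx [simp]: "plane (cplx v) = v"
  by (simp add: cplx_def plane_def vec_eq_iff forall_2)

lemma cmod_cplx [simp]: "cmod (cplx v) = norm v"
  by (simp add: cplx_def cmod_def norm_vec_def L2_set_def sum_2)

lemma norm_plane [simp]: "norm (plane z) = cmod z"
  by (metis cmod_cplx cplx_plane)

lemma bounded_linear_cplx: "bounded_linear cplx"
proof
  show "\<exists>K. \<forall>x. cmod (cplx x) \<le> norm x * K"
    by (rule exI[of _ 1]) simp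
qed (auto simp: cplx_def complex_eq_iff)

lemma bounded_linear_plane: "bounded_linear plane"
proof
  show "\<exists>K. \<forall>x. norm (plane x) \<le> cmod x * K"
    by (rule exI[of _ 1]) simp
qed (auto simp: plane_def vec_eq_iff forall_2)

lemma has_derivative_plane_conjugate:
  assumes "(G has_derivative (\<lambda>h. \<alpha> * h + \<beta> * cnj h)) (at (cplx v))"
  shows "((\<lambda>v. plane (G (cplx v))) has_derivative (\<lambda>h. plane (\<alpha> * cplx h + \<beta> * cnj (cplx h)))) (at v)"
proof -
  have "((\<lambda>v. G (cplx v)) has_derivative (\<lambda>h. \<alpha> * cplx h + \<beta> * cnj (cplx h))) (at v)"
    by (rule has_derivative_compose[OF bounded_linear_imp_has_derivative[OF bounded_linear_cplx] assms])
  then show ?thesis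
    by (rule bounded_linear.has_derivative[OF bounded_linear_plane])
qed

text \<open>Every real-linear map of the plane has the form \<open>h \<mapsto> \<alpha> h + \<beta> \<cdot> cnj h\<close>; in complex
  notation its determinant is a difference of squares. The case \<open>\<beta> = 0\<close> is a holomorphic map, the case
  \<open>\<beta> \<noteq> 0\<close> is needed for the affine correction in the area theorem.\<close>

lemma det_real_linear:
  "det (matrix (\<lambda>h. plane (\<alpha> * cplx h + \<beta> * cnj (cplx h)))) = (cmod \<alpha>)\<^sup>2 - (cmod \<beta>)\<^sup>2"
proof -
  have ax: "cplx (axis 1 1) = 1" "cplx (axis 2 1) = \<i>"
    by (simp_all add: cplx_def axis_def complex_eq_iff)
  show ?thesis
    unfolding det_2 matrix_def
    by (simp add: ax plane_def cmod_power2 power2_eq_square[of "Re _"] power2_eq_square[of "Im _"] algebra_simps)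
qed

lemma has_integral_area_image:
  assumes S: "S \<in> sets lebesgue"
    and der: "\<And>v. v \<in> S \<Longrightarrow> (G has_derivative (\<lambda>h. \<alpha> v * h + \<beta> v * cnj h)) (at (cplx v))"
    and inj: "inj_on G (cplx ` S)"
  shows "(\<lambda>v. plane (G (cplx v))) ` S \<in> lmeasurable \<and>
      measure lebesgue ((\<lambda>v. plane (G (cplx v))) ` S) = m
    \<longleftrightarrow> ((\<lambda>v. \<bar>(cmod (\<alpha> v))\<^sup>2 - (cmod (\<beta> v))\<^sup>2\<bar>) has_integral m) S"
proof -
  have "inj_on (\<lambda>v. plane (G (cplx v))) S"
    using inj unfolding inj_on_def by (metis cplx_plane image_eqI plane_cplx)
  then show ?thesis
    using has_measure_differentiable_image[OF S, of "\<lambda>v. plane (G (cplx v))"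
        "\<lambda>v h. plane (\<alpha> v * cplx h + \<beta> v * cnj (cplx h))" m]
      has_derivative_at_withinI[OF has_derivative_plane_conjugate[OF der]]
    by (simp add: det_real_linear)
qed


section \<open>Integrals over annuli\<close>

definition annulus :: "real \<Rightarrow> real \<Rightarrow> (real^2) set" where
  "annulus s t = {v. s \<le> norm v \<and> norm v \<le> t}"

lemma annulus_eq: "annulus s t = cball 0 t - ball 0 s"
  by (auto simp: annulus_def)

lemma compact_annulus: "compact (annulus s t)"
  unfolding annulus_eq by (intro compact_diff) auto

lemma lmeasurable_annulus: "annulus s t \<in> lmeasurable"
  by (simp add: compact_annulus lmeasurable_compact)

lemma measure_annulus:
  assumes "0 \<le> s" "s \<le> t"
  shows "measure lebesgue (annulus s t) = pi * (t\<^sup>2 - s\<^sup>2)"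
proof -
  have "measure lebesgue (annulus s t)
      = measure lebesgue (cball (0::real^2) t) - measure lebesgue (ball (0::real^2) s)"
    unfolding annulus_eq using assms
    by (intro measurable_measure_Diff) auto
  then show ?thesis
    using assms by (simp add: content_ball content_cball unit_ball_vol_2 power2_eq_square algebra_simps)
qed

lemma continuous_on_annulus_integrable:
  fixes f :: "complex \<Rightarrow> real"
  assumes "continuous_on {z. s \<le> cmod z \<and> cmod z \<le> t} f"
  shows "(\<lambda>v. f (cplx v)) absolutely_integrable_on annulus s t"
proof -
  have "continuous_on (annulus s t) (\<lambda>v. f (cplx v))"
    by (intro continuous_on_compose2[OF assms] linear_continuous_on bounded_linear_cplx)
      (auto simp: annulus_def)
  then have "set_integrable lborel (annulus s t) (\<lambda>v. f (cplx v))"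
    unfolding set_integrable_def
    by (intro borel_integrable_compact compact_annulus)
  then show ?thesis
    by (simp add: set_integrable_def integrable_completion)
qed

text \<open>A rotation is an invertible linear map of determinant 1 that preserves the annulus.\<close>

lemma integral_annulus_rotate:
  fixes f :: "complex \<Rightarrow> real"
  assumes f: "continuous_on {z. s \<le> cmod z \<and> cmod z \<le> t} f" and \<omega>: "cmod \<omega> = 1"
  shows "integral (annulus s t) (\<lambda>v. f (\<omega> * cplx v)) = integral (annulus s t) (\<lambda>v. f (cplx v))"
proof -
  have mul: "((\<lambda>v. plane (\<eta> * cplx v)) has_derivative (\<lambda>h. plane (\<eta> * cplx h + 0 * cnj (cplx h)))) (at v within X)"
    for \<eta> v X
  proof (rule has_derivative_at_withinI, rule has_derivative_plane_conjugate)
    show "((*) \<eta> has_derivative (\<lambda>h. \<eta> * h + 0 * cnj h)) (at (cplx v))"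
      by (simp add: bounded_linear_imp_has_derivative bounded_linear_mult_right)
  qed
  have inv: "\<omega> * cnj \<omega> = 1" "cnj \<omega> * \<omega> = 1"
    using complex_norm_square[of \<omega>] \<omega> by (simp_all add: mult.commute[of "cnj \<omega>"])
  have "(\<lambda>x. \<bar>det (matrix (\<lambda>h. plane (\<omega> * cplx h + 0 * cnj (cplx h))))\<bar> * f (cplx (plane (\<omega> * cplx x))))
        absolutely_integrable_on annulus s t \<and>
      integral (annulus s t) (\<lambda>x. \<bar>det (matrix (\<lambda>h. plane (\<omega> * cplx h + 0 * cnj (cplx h))))\<bar> *
         f (cplx (plane (\<omega> * cplx x)))) = integral (annulus s t) (\<lambda>v. f (cplx v))"
  proof (rule iffD2[OF cov_invertible_real
        [where S = "annulus s t" and T = "annulus s t" and h = "\<lambda>v. plane (cnj \<omega> * cplx v)"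
          and h' = "\<lambda>_ h. plane (cnj \<omega> * cplx h + 0 * cnj (cplx h))",
         OF mul mul]])
    show "plane (\<omega> * cplx v) \<in> annulus s t \<and> plane (cnj \<omega> * cplx (plane (\<omega> * cplx v))) = v"
      if "v \<in> annulus s t" for v
      using that \<omega> inv by (simp add: annulus_def norm_mult mult.assoc[symmetric])
    show "plane (cnj \<omega> * cplx v) \<in> annulus s t \<and> plane (\<omega> * cplx (plane (cnj \<omega> * cplx v))) = v"
      if "v \<in> annulus s t" for v
      using that \<omega> inv by (simp add: annulus_def norm_mult mult.assoc[symmetric])
    show "(\<lambda>h. plane (cnj \<omega> * cplx h + 0 * cnj (cplx h))) \<circ>
        (\<lambda>h. plane (\<omega> * cplx h + 0 * cnj (cplx h))) = id"
      using inv by (simp add: fun_eq_iff mult.assoc[symmetric])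
    show "(\<lambda>v. f (cplx v)) absolutely_integrable_on annulus s t \<and>
        integral (annulus s t) (\<lambda>v. f (cplx v)) = integral (annulus s t) (\<lambda>v. f (cplx v))"
      using continuous_on_annulus_integrable[OF f] by simp
  qed
  then show ?thesis
    unfolding det_real_linear using \<omega> by simp
qed

lemma inversion_in_annulus:
  assumes "0 < s" "v \<in> annulus s t"
  shows "plane (inverse (cplx v)) \<in> annulus (1 / t) (1 / s)"
proof -
  have "s \<le> norm v" "norm v \<le> t" "0 < norm v"
    using assms by (auto simp: annulus_def)
  then show ?thesis
    using assms(1) by (auto simp: annulus_def norm_inverse norm_divide inverse_eq_divide intro: frac_le)
qed

text \<open>The integrand is the Jacobian of the inversion, which exchanges two annuli of known area. So the
  integral needs no polar coordinates.\<close>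

lemma has_integral_annulus_inverse_norm_power4:
  assumes "0 < s" "s \<le> t"
  shows "((\<lambda>v. 1 / norm v ^ 4) has_integral pi * (1 / s\<^sup>2 - 1 / t\<^sup>2)) (annulus s t)"
proof -
  have nz: "cplx v \<noteq> 0" if "v \<in> annulus s t" for v
    using that assms cmod_cplx[of v] by (auto simp: annulus_def simp del: cmod_cplx)
  have "(\<lambda>v. plane (inverse (cplx v))) ` annulus s t = annulus (1 / t) (1 / s)"
  proof (rule set_eqI, rule iffI)
    fix w assume "w \<in> annulus (1 / t) (1 / s)"
    then have "plane (inverse (cplx w)) \<in> annulus s t"
      using inversion_in_annulus[of "1 / t" w "1 / s"] assms by simp
    moreover have "w = plane (inverse (cplx (plane (inverse (cplx w)))))"
      by simp
    ultimately show "w \<in> (\<lambda>v. plane (inverse (cplx v))) ` annulus s t"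
      by (rule rev_image_eqI)
  qed (use assms inversion_in_annulus in auto)
  moreover have "measure lebesgue (annulus (1 / t) (1 / s)) = pi * (1 / s\<^sup>2 - 1 / t\<^sup>2)"
    using assms by (subst measure_annulus) (auto simp: field_simps)
  ultimately have "((\<lambda>v. \<bar>(cmod (- (inverse (cplx v) ^ 2)))\<^sup>2 - (cmod 0)\<^sup>2\<bar>) has_integral
      pi * (1 / s\<^sup>2 - 1 / t\<^sup>2)) (annulus s t)"
  proof (subst has_integral_area_image[where G = inverse, symmetric])
    show "(inverse has_derivative (\<lambda>h. - ((inverse (cplx v))\<^sup>2) * h + 0 * cnj h)) (at (cplx v))"
      if "v \<in> annulus s t" for v
      using nz[OF that]
      by (auto intro!: derivative_eq_intros simp: power2_eq_square)
  qed (auto intro!: inj_onI lmeasurable_annulus simp: fmeasurableD[OF lmeasurable_annulus])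
  then show ?thesis
    by (simp add: norm_power norm_inverse divide_inverse power_inverse flip: power_mult)
qed

text \<open>The mean value property, smeared over an annulus. A monomial \<open>c z^n\<close> with \<open>n > 0\<close> changes sign
  under rotation by the angle \<open>\<pi>/n\<close>, so its weighted integral is its own negative; the power series
  of \<open>k\<close>, which converges absolutely on the closed disk of radius \<open>t\<close>, is then summed by dominated
  convergence.\<close>

lemma has_integral_annulus_radial_holomorphic:
  fixes w :: "real \<Rightarrow> real" and k :: "complex \<Rightarrow> complex"
  assumes k: "k holomorphic_on ball 0 R" "k 0 = 0" and t: "0 < t" "t < R"
    and w: "continuous_on {s..t} w"
  shows "((\<lambda>v. w (norm v) * Re (k (cplx v))) has_integral 0) (annulus s t)"
proof -
  define A where "A = {z::complex. s \<le> cmod z \<and> cmod z \<le> t}"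
  define c where "c n = (deriv ^^ n) k 0 / fact n" for n
  have wA: "continuous_on A (\<lambda>z. w (cmod z))"
    by (rule continuous_on_compose2[OF w]) (auto simp: A_def intro!: continuous_intros)
  have sums: "(\<lambda>n. c n * z ^ n) sums k z" if "cmod z < R" for z
    using holomorphic_power_series[OF k(1), of z] that by (simp add: c_def)
  have c0: "c 0 = 0"
    using k(2) by (simp add: c_def)
  have "summable (\<lambda>n. c n * complex_of_real ((t + R) / 2) ^ n)"
    by (rule sums_summable, rule sums) (use t in \<open>simp add: cmod_def\<close>)
  then have summ: "summable (\<lambda>n. norm (c n * complex_of_real t ^ n))"
    by (rule powser_insidea) (use t in \<open>simp add: cmod_def\<close>)
  have monomial: "((\<lambda>v. w (norm v) * Re (c n * cplx v ^ n)) has_integral 0) (annulus s t)" for n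
  proof (cases "n = 0")
    case False
    define f where "f z = w (cmod z) * Re (c n * z ^ n)" for z
    have f: "continuous_on A f"
      unfolding f_def by (intro continuous_intros wA)
    have int: "(\<lambda>v. f (cplx v)) integrable_on annulus s t"
      using continuous_on_annulus_integrable f set_lebesgue_integral_eq_integral(1) unfolding A_def by blast
    define \<omega> where "\<omega> = cis (pi / n)"
    have "\<omega> ^ n = cis (real n * (pi / n))"
      unfolding \<omega>_def by (rule Complex.DeMoivre)
    then have \<omega>: "cmod \<omega> = 1" "\<omega> ^ n = -1"
      using False by (simp_all add: \<omega>_def)
    have "integral (annulus s t) (\<lambda>v. f (cplx v)) = integral (annulus s t) (\<lambda>v. f (\<omega> * cplx v))"
      using integral_annulus_rotate[OF f[unfolded A_def] \<omega>(1)] by simp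
    also have "(\<lambda>v. f (\<omega> * cplx v)) = (\<lambda>v. - f (cplx v))"
      using \<omega> by (simp add: f_def norm_mult power_mult_distrib fun_eq_iff algebra_simps)
    finally have "integral (annulus s t) (\<lambda>v. f (cplx v)) = 0"
      by simp
    then show ?thesis
      using int by (simp add: f_def has_integral_iff)
  qed (simp add: c0)
  have partial: "((\<lambda>v. w (norm v) * Re (\<Sum>n<N. c n * cplx v ^ n)) has_integral 0) (annulus s t)" for N
    using has_integral_sum[of "{..<N}", OF _ monomial] by (simp add: sum_distrib_left Re_sum)
  obtain W where "\<forall>y\<in>w ` {s..t}. norm y \<le> W"
    using compact_imp_bounded[OF compact_continuous_image[OF w compact_Icc]]
    unfolding bounded_iff by blast
  then have W: "\<bar>w r\<bar> \<le> W" if "r \<in> {s..t}" for r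
    using that by auto
  define M where "M = (\<Sum>n. norm (c n * complex_of_real t ^ n))"
  show ?thesis
  proof (rule has_integral_dominated_convergence[OF partial, where h = "\<lambda>_. W * M"])
    show "(\<lambda>_. W * M) integrable_on annulus s t"
      using lmeasurable_annulus by (rule integrable_on_const)
    show "\<forall>v\<in>annulus s t. norm (w (norm v) * Re (\<Sum>n<N. c n * cplx v ^ n)) \<le> W * M" for N
    proof
      fix v assume v: "v \<in> annulus s t"
      have "cmod (\<Sum>n<N. c n * cplx v ^ n) \<le> (\<Sum>n<N. cmod (c n) * t ^ n)"
        using v t by (auto intro!: sum_norm_le mult_left_mono power_mono simp: norm_mult norm_power annulus_def)
      also have "\<dots> = (\<Sum>n<N. norm (c n * complex_of_real t ^ n))"
        using t by (simp add: norm_mult norm_power)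
      also have "\<dots> \<le> M"
        unfolding M_def by (rule sum_le_suminf[OF summ]) auto
      finally have "\<bar>Re (\<Sum>n<N. c n * cplx v ^ n)\<bar> \<le> M"
        using abs_Re_le_cmod order_trans by blast
      moreover have "\<bar>w (norm v)\<bar> \<le> W"
        using v by (intro W) (auto simp: annulus_def)
      ultimately show "norm (w (norm v) * Re (\<Sum>n<N. c n * cplx v ^ n)) \<le> W * M"
        unfolding real_norm_def abs_mult by (intro mult_mono) auto
    qed
    show "\<forall>v\<in>annulus s t. (\<lambda>N. w (norm v) * Re (\<Sum>n<N. c n * cplx v ^ n)) \<longlonglongrightarrow> w (norm v) * Re (k (cplx v))"
      using t by (intro ballI tendsto_mult tendsto_const tendsto_Re sums[unfolded sums_def])
        (auto simp: annulus_def)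
  qed simp
qed


section \<open>The area theorem\<close>

text \<open>Near the pole, \<open>w = 1/z + b z + e\<close> maps the circle of radius \<open>s\<close> almost onto an ellipse: on
  this circle \<open>z = s\<^sup>2 \<cdot> cnj (1/z)\<close>, so \<open>1/z + b z\<close> is the real-linear image \<open>u + b s\<^sup>2 \<cdot> cnj u\<close> of
  \<open>u = 1/z\<close>. The real-linear map \<open>w \<mapsto> w - b s\<^sup>2 \<cdot> cnj w\<close> undoes this distortion up to higher order
  terms. The bound holds on the whole annulus and not only on the inner circle because, for small
  \<open>s\<close>, the dominant term \<open>1 / cmod z\<close> decreases faster than all the others can grow. The error
  \<open>O(s\<^sup>2)\<close> in the radius changes the area by only \<open>O(s)\<close>; the undistorted image lies merely in a disk
  of radius \<open>1/s + O(s)\<close>, which is too large by an amount of area that does not vanish with \<open>s\<close>.\<close>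

lemma nearly_circular_image:
  fixes b z :: complex
  assumes C: "0 \<le> C" "cmod (e) \<le> C * (cmod z)\<^sup>2"
    and z: "s \<le> cmod z" "cmod z \<le> 1"
    and s: "0 < s" "cmod b * s\<^sup>2 \<le> 1/2" "s * (2 * (cmod b + (cmod b)\<^sup>2 + 4 * C)) \<le> 1"
    and w: "w = 1 / z + b * z + e"
  shows "cmod (w - b * of_real (s\<^sup>2) * cnj w) \<le> 1 / s + ((cmod b)\<^sup>2 + 2 * C) * s\<^sup>2"
proof -
  define r where "r = cmod z"
  define \<beta> where "\<beta> = cmod b"
  have pos: "0 < r" "0 \<le> \<beta>" "r \<le> 1" "s \<le> r" "s \<le> 1"
    using z s by (auto simp: r_def \<beta>_def)
  then have z0: "z \<noteq> 0"
    by (auto simp: r_def)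
  have cnj: "cnj (1 / z) = z / of_real (r\<^sup>2)"
    using z0 complex_norm_square[of z] by (simp add: r_def field_simps)
  have "w - b * of_real (s\<^sup>2) * cnj w = 1 / z + b * z * of_real (1 - s\<^sup>2 / r\<^sup>2)
      - b * of_real (s\<^sup>2) * cnj (b * z) + (e - b * of_real (s\<^sup>2) * cnj e)"
  proof -
    have "cnj w = z / of_real (r\<^sup>2) + cnj (b * z) + cnj e"
      unfolding w cnj[symmetric] by simp
    then show ?thesis
      unfolding w by (simp add: algebra_simps)
  qed
  also have "cmod \<dots> \<le> cmod (1 / z) + cmod (b * z * of_real (1 - s\<^sup>2 / r\<^sup>2))
      + cmod (b * of_real (s\<^sup>2) * cnj (b * z)) + (cmod e + cmod (b * of_real (s\<^sup>2) * cnj e))"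
    by (intro norm_triangle_le norm_triangle_le_diff add_mono order_refl norm_triangle_ineq4)
  also have "\<dots> \<le> 1 / r + \<beta> * r * (1 - s\<^sup>2 / r\<^sup>2) + \<beta>\<^sup>2 * s\<^sup>2 * r + 2 * C * r\<^sup>2"
  proof -
    have "s\<^sup>2 / r\<^sup>2 \<le> 1"
      using pos s by (simp add: power_mono)
    then have "cmod (b * z * of_real (1 - s\<^sup>2 / r\<^sup>2)) = \<beta> * r * (1 - s\<^sup>2 / r\<^sup>2)"
      unfolding norm_mult norm_of_real by (simp add: r_def \<beta>_def)
    moreover have "cmod e + cmod (b * of_real (s\<^sup>2) * cnj e) \<le> 2 * C * r\<^sup>2"
    proof -
      have "cmod e + cmod (b * of_real (s\<^sup>2) * cnj e) = (1 + \<beta> * s\<^sup>2) * cmod e"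
        by (simp add: norm_mult \<beta>_def algebra_simps norm_power)
      also have "\<dots> \<le> 2 * (C * r\<^sup>2)"
        using s C by (intro mult_mono) (auto simp: \<beta>_def r_def)
      finally show ?thesis by simp
    qed
    moreover have "cmod (b * of_real (s\<^sup>2) * cnj (b * z)) = \<beta>\<^sup>2 * s\<^sup>2 * r"
      by (simp add: norm_mult norm_power r_def \<beta>_def power2_eq_square)
    moreover have "cmod (1 / z) = 1 / r"
      by (simp add: norm_divide r_def)
    ultimately show ?thesis
      by linarith
  qed
  also have "\<dots> \<le> 1 / s + (\<beta>\<^sup>2 + 2 * C) * s\<^sup>2"
  proof -
    have "\<beta> + \<beta>\<^sup>2 * s\<^sup>2 + 2 * C * (r + s) \<le> \<beta> + \<beta>\<^sup>2 * 1 + 2 * C * 2"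
      using pos s C by (intro add_mono mult_left_mono) (auto intro!: power_le_one)
    also have "\<dots> \<le> (1 / 2) / s"
      using s by (simp add: \<beta>_def field_simps)
    also have "\<dots> \<le> (1 - \<beta> * s\<^sup>2) / (r * s)"
      using pos s by (intro frac_le) (auto simp: \<beta>_def)
    \<comment> \<open>The right-hand side is the amount by which the bound on the circle of radius \<open>s\<close> exceeds the bound at \<open>z\<close>; the factor \<open>r - s\<close> splits off.\<close>
    finally have "0 \<le> (r - s) * ((1 - \<beta> * s\<^sup>2) / (r * s) - (\<beta> + \<beta>\<^sup>2 * s\<^sup>2 + 2 * C * (r + s)))"
      using pos by (intro mult_nonneg_nonneg) auto
    also have "\<dots> = 1 / s + \<beta>\<^sup>2 * s\<^sup>2 * s + 2 * C * s\<^sup>2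
        - (1 / r + \<beta> * r * (1 - s\<^sup>2 / r\<^sup>2) + \<beta>\<^sup>2 * s\<^sup>2 * r + 2 * C * r\<^sup>2)"
      using pos s(1) by (simp add: field_simps power2_eq_square)
    finally have "1 / r + \<beta> * r * (1 - s\<^sup>2 / r\<^sup>2) + \<beta>\<^sup>2 * s\<^sup>2 * r + 2 * C * r\<^sup>2
        \<le> 1 / s + \<beta>\<^sup>2 * s\<^sup>2 * s + 2 * C * s\<^sup>2"
      by simp
    moreover have "\<beta>\<^sup>2 * s\<^sup>2 * s \<le> \<beta>\<^sup>2 * s\<^sup>2 * 1"
      using pos by (intro mult_left_mono) auto
    ultimately show ?thesis
      by (simp add: algebra_simps)
  qed
  finally show ?thesis
    by (simp add: \<beta>_def)
qed

lemma holomorphic_second_order_remainder: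
  assumes h: "h holomorphic_on ball 0 1" and t: "t < 1"
  obtains C where "0 \<le> C"
    "\<And>z. cmod z \<le> t \<Longrightarrow> cmod (h z - h 0 - deriv h 0 * z) \<le> C * (cmod z)\<^sup>2"
proof -
  define p where "p = (\<lambda>z. if z = 0 then deriv h 0 else (h z - h 0) / (z - 0))"
  define q where "q = (\<lambda>z. if z = 0 then deriv p 0 else (p z - p 0) / (z - 0))"
  have "p holomorphic_on ball 0 1"
    unfolding p_def by (intro pole_lemma_open h) simp
  then have "q holomorphic_on ball 0 1"
    unfolding q_def by (rule pole_lemma_open) simp
  then have "continuous_on (cball 0 t) q"
    using t by (intro holomorphic_on_imp_continuous_on) (auto elim: holomorphic_on_subset)
  then have "bounded (q ` cball 0 t)"
    by (intro compact_imp_bounded compact_continuous_image compact_cball)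
  then obtain C where C: "0 < C" "\<And>z. cmod z \<le> t \<Longrightarrow> cmod (q z) \<le> C"
    unfolding bounded_pos by auto
  have eq: "h z - h 0 - deriv h 0 * z = q z * z\<^sup>2" for z
    by (auto simp: p_def q_def field_simps power2_eq_square)
  show ?thesis
  proof (rule that)
    show "cmod (h z - h 0 - deriv h 0 * z) \<le> C * (cmod z)\<^sup>2" if "cmod z \<le> t" for z
      unfolding eq norm_mult norm_power by (intro mult_right_mono C that) auto
  qed (use C in auto)
qed

text \<open>Parseval's formula for the first two Laurent coefficients of the derivative of \<open>1/z + h z\<close>.
  The three parts \<open>- 1/z\<^sup>2\<close>, \<open>b\<close> and \<open>deriv h z - b\<close> are mutually orthogonal on annuli, since the
  cross terms are radial weights times real parts of holomorphic functions that vanish at 0.\<close>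

lemma has_integral_laurent_deriv_square:
  assumes h: "h holomorphic_on ball 0 1" and s: "0 < s" "s \<le> t" and t: "t < 1"
  defines "b \<equiv> deriv h 0"
  shows "((\<lambda>v. (cmod (- (1 / (cplx v)\<^sup>2) + deriv h (cplx v)))\<^sup>2) has_integral
      pi * (1 / s\<^sup>2 - 1 / t\<^sup>2) + (cmod b)\<^sup>2 * (pi * (t\<^sup>2 - s\<^sup>2))
        + integral (annulus s t) (\<lambda>v. (cmod (deriv h (cplx v) - b))\<^sup>2)) (annulus s t)"
proof -
  define q where "q z = deriv h z - b" for z
  have dh: "deriv h holomorphic_on ball 0 1"
    using h by (rule holomorphic_deriv) simp
  then have q: "q holomorphic_on ball 0 1" "q 0 = 0"
    unfolding q_def by (auto intro!: holomorphic_intros simp: b_def)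
  have cont: "continuous_on {s..t} (\<lambda>r. - 2 / r ^ 4)" "continuous_on {s..t} (\<lambda>r. 2::real)"
    using s by (auto intro!: continuous_intros)
  have "((\<lambda>v. 2 * Re (cnj b * q (cplx v))) has_integral 0) (annulus s t)"
    using q s t by (intro has_integral_annulus_radial_holomorphic[where R = 1] cont)
      (auto intro!: holomorphic_intros)
  moreover have "((\<lambda>v. - 2 / norm v ^ 4 * Re ((cplx v)\<^sup>2 * deriv h (cplx v))) has_integral 0) (annulus s t)"
    using dh s t
    by (intro has_integral_annulus_radial_holomorphic
        [where R = 1 and w = "\<lambda>r. - 2 / r ^ 4" and k = "\<lambda>z. z\<^sup>2 * deriv h z"] cont)
      (auto intro!: holomorphic_intros)
  moreover have "((\<lambda>v. 1 / norm v ^ 4) has_integral pi * (1 / s\<^sup>2 - 1 / t\<^sup>2)) (annulus s t)"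
    using s by (intro has_integral_annulus_inverse_norm_power4)
  moreover have "((\<lambda>v. (cmod b)\<^sup>2) has_integral (cmod b)\<^sup>2 * (pi * (t\<^sup>2 - s\<^sup>2))) (annulus s t)"
  proof -
    have "((\<lambda>v. 1) has_integral pi * (t\<^sup>2 - s\<^sup>2)) (annulus s t)"
      using lmeasurable_annulus[of s t] measure_annulus[of s t] s
      by (simp add: has_integral_iff lmeasure_integral lmeasurable_iff_integrable_on)
    from has_integral_mult_right[OF this, of "(cmod b)\<^sup>2"] show ?thesis
      by simp
  qed
  moreover have "((\<lambda>v. (cmod (q (cplx v)))\<^sup>2) has_integral
      integral (annulus s t) (\<lambda>v. (cmod (q (cplx v)))\<^sup>2)) (annulus s t)"
  proof -
    have "continuous_on {z. s \<le> cmod z \<and> cmod z \<le> t} q"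
      using t by (intro holomorphic_on_imp_continuous_on holomorphic_on_subset[OF q(1)]) auto
    then have "(\<lambda>v. (cmod (q (cplx v)))\<^sup>2) absolutely_integrable_on annulus s t"
      by (intro continuous_on_annulus_integrable continuous_intros)
    then show ?thesis
      using set_lebesgue_integral_eq_integral(1) by blast
  qed
  ultimately have "((\<lambda>v. 2 * Re (cnj b * q (cplx v))
        + (- 2 / norm v ^ 4 * Re ((cplx v)\<^sup>2 * deriv h (cplx v)) + (1 / norm v ^ 4
        + ((cmod b)\<^sup>2 + (cmod (q (cplx v)))\<^sup>2))))
      has_integral 0 + (0 + (pi * (1 / s\<^sup>2 - 1 / t\<^sup>2) + ((cmod b)\<^sup>2 * (pi * (t\<^sup>2 - s\<^sup>2))
        + integral (annulus s t) (\<lambda>v. (cmod (q (cplx v)))\<^sup>2))))) (annulus s t)"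
    by (intro has_integral_add)
  then show ?thesis
  proof (rule has_integral_eq[rotated, where s = "annulus s t", THEN has_integral_eq_rhs])
    fix v assume "v \<in> annulus s t"
    define z where "z = cplx v"
    have z: "cmod z = norm v" "z \<noteq> 0"
      using \<open>v \<in> annulus s t\<close> s cmod_cplx[of v] by (auto simp: z_def annulus_def simp del: cmod_cplx)
    \<comment> \<open>Applied below with \<open>w = q z\<close>, so that \<open>b + w = deriv h z\<close>, and \<open>u = 1 / z\<^sup>2\<close>, for which \<open>cnj u = z\<^sup>2 / cmod z ^ 4\<close>.\<close>
    have expand: "(cmod (- u + b + w))\<^sup>2
        = 2 * Re (cnj b * w) - 2 * Re (cnj u * (b + w)) + (cmod u)\<^sup>2 + (cmod b)\<^sup>2 + (cmod w)\<^sup>2" for u w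
      unfolding cmod_power2 by (simp add: power2_eq_square algebra_simps)
    have "cnj (1 / z\<^sup>2) = z\<^sup>2 / of_real (cmod z ^ 4)"
    proof -
      have "complex_of_real (cmod z ^ 4) = (of_real ((cmod z)\<^sup>2))\<^sup>2"
        by (simp flip: power_mult)
      also have "\<dots> = (z * cnj z)\<^sup>2"
        by (simp only: complex_norm_square)
      finally show ?thesis
        using z by (simp add: field_simps power_mult_distrib)
    qed
    then have "Re (cnj (1 / z\<^sup>2) * deriv h z) = Re (z\<^sup>2 * deriv h z) / norm v ^ 4"
      using z by (simp add: Re_divide_of_real del: of_real_power)
    moreover have "(cmod (1 / z\<^sup>2))\<^sup>2 = 1 / norm v ^ 4"
      using z by (simp add: norm_divide norm_power power_divide flip: power_mult)
    ultimately show "2 * Re (cnj b * q (cplx v))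
        + (- 2 / norm v ^ 4 * Re ((cplx v)\<^sup>2 * deriv h (cplx v)) + (1 / norm v ^ 4
        + ((cmod b)\<^sup>2 + (cmod (q (cplx v)))\<^sup>2)))
      = (cmod (- (1 / (cplx v)\<^sup>2) + deriv h (cplx v)))\<^sup>2"
      using expand[of "1 / z\<^sup>2" "q z"] by (simp add: q_def flip: z_def)
  qed (simp add: q_def)
qed

text \<open>The quantitative form of the area theorem, which bounds everything beyond the coefficient
  \<open>b\<close> as well. For a small inner radius \<open>s\<close> the corrected map \<open>G z = \<phi> z - c \<cdot> cnj (\<phi> z)\<close> with
  \<open>c = b s\<^sup>2\<close> is still injective and sends the annulus into a disk of radius \<open>1/s + K s\<^sup>2\<close>. Its Jacobian
  is \<open>1 - (cmod c)\<^sup>2\<close> times that of \<open>\<phi>\<close>, so the area of its image is known from Parseval's formula.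
  The term \<open>\<pi> / s\<^sup>2\<close> occurs on both sides of the resulting inequality, and what remains has a limit
  as \<open>s\<close> tends to 0.\<close>

lemma area_inequality:
  assumes h: "h holomorphic_on ball 0 1"
    and inj: "inj_on (\<lambda>z. 1 / z + h z) (ball 0 1 - {0})"
    and st: "0 < \<sigma>" "\<sigma> \<le> t" "t < 1"
  defines "b \<equiv> deriv h 0"
  shows "integral (annulus \<sigma> t) (\<lambda>v. (cmod (deriv h (cplx v) - b))\<^sup>2) \<le> pi * (1 / t\<^sup>2 - (cmod b)\<^sup>2 * t\<^sup>2)"
proof -
  define \<beta> where "\<beta> = cmod b"
  have \<beta>: "0 \<le> \<beta>"
    by (simp add: \<beta>_def)
  define Q where "Q s = integral (annulus s t) (\<lambda>v. (cmod (deriv h (cplx v) - b))\<^sup>2)" for s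
  obtain C where C: "0 \<le> C" "\<And>z. cmod z \<le> t \<Longrightarrow> cmod (h z - h 0 - b * z) \<le> C * (cmod z)\<^sup>2"
    using holomorphic_second_order_remainder[OF h st(3)] unfolding b_def by blast
  define K where "K = \<beta>\<^sup>2 + 2 * C"
  define \<phi> where "\<phi> z = 1 / z + (h z - h 0)" for z
  define \<phi>' where "\<phi>' z = - (1 / z\<^sup>2) + deriv h z" for z
  have Q_mono: "Q \<sigma> \<le> Q s" if "0 < s" "s \<le> \<sigma>" for s
  proof -
    have int: "(\<lambda>v. (cmod (deriv h (cplx v) - b))\<^sup>2) integrable_on annulus r t" for r
    proof -
      have "deriv h holomorphic_on {z. r \<le> cmod z \<and> cmod z \<le> t}"
        by (rule holomorphic_on_subset[OF holomorphic_deriv[OF h open_ball]]) (use st in auto)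
      then have "(\<lambda>v. (cmod (deriv h (cplx v) - b))\<^sup>2) absolutely_integrable_on annulus r t"
        by (intro continuous_on_annulus_integrable continuous_intros holomorphic_on_imp_continuous_on)
      then show ?thesis
        using set_lebesgue_integral_eq_integral(1) by blast
    qed
    show ?thesis
      unfolding Q_def using that by (intro integral_subset_le int) (auto simp: annulus_def)
  qed
  \<comment> \<open>The area of the image under the corrected map, compared with that of the disk and divided by \<open>\<pi>\<close>.\<close>
  have area: "(1 - \<beta>\<^sup>2 * s ^ 4) * (1 / s\<^sup>2 - 1 / t\<^sup>2 + \<beta>\<^sup>2 * (t\<^sup>2 - s\<^sup>2) + Q s / pi) \<le> (1 / s + K * s\<^sup>2)\<^sup>2"
    if s: "0 < s" "s \<le> \<sigma>" "\<beta> * s\<^sup>2 \<le> 1/2" "s * (2 * (\<beta> + \<beta>\<^sup>2 + 4 * C)) \<le> 1" for s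
  proof -
    define c where "c = b * of_real (s\<^sup>2)"
    define G where "G z = \<phi> z - c * cnj (\<phi> z)" for z
    define I where "I = pi * (1 / s\<^sup>2 - 1 / t\<^sup>2) + \<beta>\<^sup>2 * (pi * (t\<^sup>2 - s\<^sup>2)) + Q s"
    define S where "S = (\<lambda>v. plane (G (cplx v))) ` annulus s t"
    have c: "cmod c = \<beta> * s\<^sup>2"
      by (simp add: c_def \<beta>_def norm_mult norm_power)
    have c2: "(cmod c)\<^sup>2 = \<beta>\<^sup>2 * s ^ 4"
      unfolding c by (simp add: power_mult_distrib flip: power_mult)
    have c1: "cmod c < 1"
      using s c by simp
    have nz: "cplx v \<noteq> 0" "cplx v \<in> ball 0 1" "s \<le> cmod (cplx v)" "cmod (cplx v) \<le> t"
      if "v \<in> annulus s t" for v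
      using that s st cmod_cplx[of v] by (auto simp: annulus_def simp del: cmod_cplx)
    have deriv_\<phi>: "(\<phi> has_derivative (*) (\<phi>' (cplx v))) (at (cplx v))" if "v \<in> annulus s t" for v
    proof -
      have "(h has_field_derivative deriv h (cplx v)) (at (cplx v))"
        using h nz(2)[OF that] by (intro holomorphic_derivI[of h "ball 0 1"]) auto
      then have "(\<phi> has_field_derivative \<phi>' (cplx v)) (at (cplx v))"
        unfolding \<phi>_def \<phi>'_def using nz(1)[OF that]
        by (auto intro!: derivative_eq_intros simp: power2_eq_square divide_inverse)
      then show ?thesis
        by (simp add: has_field_derivative_def)
    qed
    have "((\<lambda>v. (1 - (cmod c)\<^sup>2) * (cmod (\<phi>' (cplx v)))\<^sup>2) has_integral (1 - (cmod c)\<^sup>2) * I) (annulus s t)"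
      unfolding \<phi>'_def I_def \<beta>_def Q_def b_def using s st h
      by (intro has_integral_mult_right has_integral_laurent_deriv_square) auto
    moreover have "\<bar>(cmod (\<phi>' z))\<^sup>2 - (cmod (- (c * cnj (\<phi>' z))))\<^sup>2\<bar> = (1 - (cmod c)\<^sup>2) * (cmod (\<phi>' z))\<^sup>2" for z
    proof -
      have "(cmod c)\<^sup>2 \<le> 1"
        using c1 by (simp add: power_le_one)
      then have "0 \<le> (1 - (cmod c)\<^sup>2) * (cmod (\<phi>' z))\<^sup>2"
        by simp
      then show ?thesis
        by (simp add: norm_mult power_mult_distrib algebra_simps)
    qed
    ultimately have "((\<lambda>v. \<bar>(cmod (\<phi>' (cplx v)))\<^sup>2 - (cmod (- (c * cnj (\<phi>' (cplx v)))))\<^sup>2\<bar>)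
        has_integral (1 - (cmod c)\<^sup>2) * I) (annulus s t)"
      by simp
    moreover have "(G has_derivative (\<lambda>h. \<phi>' (cplx v) * h + - (c * cnj (\<phi>' (cplx v))) * cnj h)) (at (cplx v))"
      if "v \<in> annulus s t" for v
    proof -
      have "(G has_derivative (\<lambda>h. \<phi>' (cplx v) * h - c * cnj (\<phi>' (cplx v) * h))) (at (cplx v))"
        unfolding G_def
        by (intro has_derivative_diff has_derivative_mult_right deriv_\<phi>[OF that]
            bounded_linear.has_derivative[OF bounded_linear_cnj])
      then show ?thesis
        by (rule has_derivative_eq_rhs) (simp add: fun_eq_iff)
    qed
    moreover have "inj_on G (cplx ` annulus s t)"
    proof (rule inj_onI)
      fix x y assume xy: "x \<in> cplx ` annulus s t" "y \<in> cplx ` annulus s t" "G x = G y"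
      then have "\<phi> x - \<phi> y = c * cnj (\<phi> x - \<phi> y)"
        by (simp add: G_def algebra_simps)
      then have "cmod (\<phi> x - \<phi> y) = cmod c * cmod (\<phi> x - \<phi> y)"
        by (metis complex_mod_cnj norm_mult)
      then have "\<phi> x = \<phi> y"
        using c1 by simp
      then show "x = y"
        using inj_onD[OF inj, of x y] xy(1,2) nz by (auto simp: \<phi>_def)
    qed
    ultimately have "S \<in> lmeasurable \<and> measure lebesgue S = (1 - (cmod c)\<^sup>2) * I"
      unfolding S_def by (intro iffD2[OF has_integral_area_image] fmeasurableD[OF lmeasurable_annulus])
    then have S: "S \<in> lmeasurable" "measure lebesgue S = (1 - (cmod c)\<^sup>2) * I"
      by auto
    define M where "M = 1 / s + K * s\<^sup>2"
    have M: "0 \<le> M"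
      using s C by (simp add: M_def K_def)
    have "S \<subseteq> cball 0 M"
    proof -
      have "cmod (G (cplx v)) \<le> M" if "v \<in> annulus s t" for v
        unfolding G_def c_def M_def K_def \<beta>_def
        by (rule nearly_circular_image[where e = "h (cplx v) - h 0 - b * cplx v" and z = "cplx v"])
          (use s st C nz[OF that] in \<open>auto simp: \<phi>_def \<beta>_def simp del: cmod_cplx\<close>)
      then show ?thesis
        by (auto simp: S_def)
    qed
    then have "measure lebesgue S \<le> measure lebesgue (cball (0::real^2) M)"
      using S(1) by (intro measure_mono_fmeasurable) (auto simp: fmeasurableD)
    also have "\<dots> = pi * M\<^sup>2"
      using M by (simp add: content_cball unit_ball_vol_2)
    finally have "(1 - \<beta>\<^sup>2 * s ^ 4) * I \<le> pi * M\<^sup>2"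
      unfolding S(2) c2 .
    moreover have "I = pi * (1 / s\<^sup>2 - 1 / t\<^sup>2 + \<beta>\<^sup>2 * (t\<^sup>2 - s\<^sup>2) + Q s / pi)"
      by (simp add: I_def algebra_simps)
    ultimately have "pi * ((1 - \<beta>\<^sup>2 * s ^ 4) * (1 / s\<^sup>2 - 1 / t\<^sup>2 + \<beta>\<^sup>2 * (t\<^sup>2 - s\<^sup>2) + Q s / pi)) \<le> pi * M\<^sup>2"
      by (simp only: mult.left_commute)
    then show ?thesis
      unfolding M_def by (rule mult_left_le_imp_le) simp
  qed
  \<comment> \<open>The limit as \<open>s\<close> tends to 0 of the left-hand side after cancellation of \<open>1 / s\<^sup>2\<close>, with \<open>Q s\<close> already bounded below by \<open>Q \<sigma>\<close>.\<close>
  define X where "X = - (1 / t\<^sup>2) + \<beta>\<^sup>2 * t\<^sup>2 + Q \<sigma> / pi"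
  have "X * 1 \<le> 0"
  proof (rule tendsto_le)
    show "((\<lambda>s. X * (1 - \<beta>\<^sup>2 * s ^ 4)) \<longlongrightarrow> X * 1) (at_right 0)"
      by (auto intro!: tendsto_eq_intros)
    show "((\<lambda>s. 2 * K * s + K\<^sup>2 * s ^ 4 + \<beta>\<^sup>2 * s\<^sup>2 + \<beta>\<^sup>2 * s\<^sup>2 * (1 - \<beta>\<^sup>2 * s ^ 4)) \<longlongrightarrow> 0) (at_right 0)"
      by (auto intro!: tendsto_eq_intros)
    have lim: "((\<lambda>s. \<beta> * s\<^sup>2) \<longlongrightarrow> 0) (at_right 0)"
      "((\<lambda>s. s * (2 * (\<beta> + \<beta>\<^sup>2 + 4 * C))) \<longlongrightarrow> 0) (at_right 0)"
      by (auto intro!: tendsto_eq_intros)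
    have "\<forall>\<^sub>F s in at_right (0::real). s < \<sigma>"
      using st(1) by (rule order_tendstoD(2)[OF tendsto_ident_at])
    moreover have "\<forall>\<^sub>F s in at_right 0. \<beta> * s\<^sup>2 < 1/2"
      by (rule order_tendstoD(2)[OF lim(1)]) simp
    moreover have "\<forall>\<^sub>F s in at_right 0. s * (2 * (\<beta> + \<beta>\<^sup>2 + 4 * C)) < 1"
      by (rule order_tendstoD(2)[OF lim(2)]) simp
    moreover have "\<forall>\<^sub>F s in at_right (0::real). 0 < s"
      by (rule eventually_at_right_less)
    ultimately show "\<forall>\<^sub>F s in at_right 0. X * (1 - \<beta>\<^sup>2 * s ^ 4)
        \<le> 2 * K * s + K\<^sup>2 * s ^ 4 + \<beta>\<^sup>2 * s\<^sup>2 + \<beta>\<^sup>2 * s\<^sup>2 * (1 - \<beta>\<^sup>2 * s ^ 4)"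
    proof eventually_elim
      case (elim s)
      define y where "y = 1 - \<beta>\<^sup>2 * s ^ 4"
      have "\<beta>\<^sup>2 * s ^ 4 = (\<beta> * s\<^sup>2)\<^sup>2"
        by (simp add: power_mult_distrib flip: power_mult)
      then have "0 \<le> y"
        using elim \<beta> by (simp add: y_def power_le_one)
      then have "y * (1 / s\<^sup>2 - \<beta>\<^sup>2 * s\<^sup>2 + X)
          \<le> y * (1 / s\<^sup>2 - 1 / t\<^sup>2 + \<beta>\<^sup>2 * (t\<^sup>2 - s\<^sup>2) + Q s / pi)"
        using Q_mono[of s] elim unfolding X_def
        by (intro mult_left_mono) (auto simp: algebra_simps divide_right_mono)
      also have "\<dots> \<le> (1 / s + K * s\<^sup>2)\<^sup>2"
        unfolding y_def using elim by (intro area) auto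
      also have "\<dots> = 1 / s\<^sup>2 + 2 * K * s + K\<^sup>2 * s ^ 4"
        using elim by (simp add: field_simps power2_eq_square power4_eq_xxxx)
      finally have "y * (1 / s\<^sup>2 - \<beta>\<^sup>2 * s\<^sup>2 + X) \<le> 1 / s\<^sup>2 + 2 * K * s + K\<^sup>2 * s ^ 4" .
      moreover have "y * (1 / s\<^sup>2) = 1 / s\<^sup>2 - \<beta>\<^sup>2 * s\<^sup>2"
        using elim by (simp add: y_def field_simps power2_eq_square power4_eq_xxxx)
      moreover have "y * (1 / s\<^sup>2 - \<beta>\<^sup>2 * s\<^sup>2 + X) = y * (1 / s\<^sup>2) - \<beta>\<^sup>2 * s\<^sup>2 * y + X * y"
        by (simp add: algebra_simps)
      ultimately show ?case
        unfolding y_def[symmetric] by linarith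
    qed
  qed simp
  then have "Q \<sigma> / pi \<le> 1 / t\<^sup>2 - \<beta>\<^sup>2 * t\<^sup>2"
    by (simp add: X_def)
  then show ?thesis
    by (simp add: Q_def \<beta>_def field_simps)
qed

text \<open>Both parts follow from the area inequality as the outer radius tends to 1. In the extremal
  case the limit says that \<open>deriv h - deriv h 0\<close> has square integral 0 over every annulus, so that
  \<open>h\<close> is affine.\<close>

theorem area_theorem:
  assumes h: "h holomorphic_on ball 0 1"
    and inj: "inj_on (\<lambda>z. 1 / z + h z) (ball 0 1 - {0})"
  shows "cmod (deriv h 0) \<le> 1"
    and "cmod (deriv h 0) = 1 \<Longrightarrow> z \<in> ball 0 1 \<Longrightarrow> h z = h 0 + deriv h 0 * z"
proof -
  define b where "b = deriv h 0"
  define Q where "Q \<sigma> t = integral (annulus \<sigma> t) (\<lambda>v. (cmod (deriv h (cplx v) - b))\<^sup>2)" for \<sigma> t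
  have bound: "Q \<sigma> t \<le> pi * (1 / t\<^sup>2 - (cmod b)\<^sup>2 * t\<^sup>2)" if "0 < \<sigma>" "\<sigma> \<le> t" "t < 1" for \<sigma> t
    unfolding Q_def b_def using area_inequality[OF h inj that] .
  have dh: "deriv h holomorphic_on ball 0 1"
    using h by (rule holomorphic_deriv) simp
  have int: "(\<lambda>v. (cmod (deriv h (cplx v) - b))\<^sup>2) integrable_on annulus \<sigma> t" if "t < 1" for \<sigma> t
  proof -
    have "deriv h holomorphic_on {z. \<sigma> \<le> cmod z \<and> cmod z \<le> t}"
      by (rule holomorphic_on_subset[OF dh]) (use that in auto)
    then have "(\<lambda>v. (cmod (deriv h (cplx v) - b))\<^sup>2) absolutely_integrable_on annulus \<sigma> t"
      by (intro continuous_on_annulus_integrable continuous_intros holomorphic_on_imp_continuous_on)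
    then show ?thesis
      using set_lebesgue_integral_eq_integral(1) by blast
  qed
  have near1: "\<forall>\<^sub>F t in at_left (1::real). \<sigma> < t \<and> t < 1" if "\<sigma> < 1" for \<sigma>
    using that by (auto simp: eventually_at_left intro!: exI[of _ \<sigma>])
  have "0 \<le> pi * (1 / 1\<^sup>2 - (cmod b)\<^sup>2 * 1\<^sup>2)"
  proof (rule tendsto_lowerbound)
    show "((\<lambda>t. pi * (1 / t\<^sup>2 - (cmod b)\<^sup>2 * t\<^sup>2)) \<longlongrightarrow> pi * (1 / 1\<^sup>2 - (cmod b)\<^sup>2 * 1\<^sup>2)) (at_left 1)"
      by (intro tendsto_intros) auto
    show "\<forall>\<^sub>F t in at_left 1. 0 \<le> pi * (1 / t\<^sup>2 - (cmod b)\<^sup>2 * t\<^sup>2)"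
      using near1[of "1/2", simplified]
    proof eventually_elim
      case (elim t)
      have "0 \<le> Q (1/2) t"
        unfolding Q_def using elim by (intro Henstock_Kurzweil_Integration.integral_nonneg int) auto
      also have "\<dots> \<le> pi * (1 / t\<^sup>2 - (cmod b)\<^sup>2 * t\<^sup>2)"
        using elim by (intro bound) auto
      finally show ?case .
    qed
  qed simp
  then have "(cmod b)\<^sup>2 \<le> 1"
    using not_le[of pi 0] by (simp add: zero_le_mult_iff)
  then show "cmod (deriv h 0) \<le> 1"
    by (simp add: b_def abs_square_le_1)
  assume b1: "cmod (deriv h 0) = 1" and z: "z \<in> ball 0 1"
  have Q0: "Q \<sigma> \<tau> \<le> 0" if "0 < \<sigma>" "\<sigma> < \<tau>" "\<tau> < 1" for \<sigma> \<tau>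
  proof -
    have "Q \<sigma> \<tau> \<le> pi * (1 / 1\<^sup>2 - (cmod b)\<^sup>2 * 1\<^sup>2)"
    proof (rule tendsto_lowerbound)
      show "((\<lambda>t. pi * (1 / t\<^sup>2 - (cmod b)\<^sup>2 * t\<^sup>2)) \<longlongrightarrow> pi * (1 / 1\<^sup>2 - (cmod b)\<^sup>2 * 1\<^sup>2)) (at_left 1)"
        by (intro tendsto_intros) auto
      show "\<forall>\<^sub>F t in at_left 1. Q \<sigma> \<tau> \<le> pi * (1 / t\<^sup>2 - (cmod b)\<^sup>2 * t\<^sup>2)"
        using near1[OF that(3)]
      proof eventually_elim
        case (elim t)
        have "Q \<sigma> \<tau> \<le> Q \<sigma> t"
          unfolding Q_def using elim that by (intro integral_subset_le int) (auto simp: annulus_def)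
        also have "\<dots> \<le> pi * (1 / t\<^sup>2 - (cmod b)\<^sup>2 * t\<^sup>2)"
          using elim that by (intro bound) auto
        finally show ?case .
      qed
    qed simp
    then show ?thesis
      using b1 by (simp add: b_def)
  qed
  have dh_eq: "deriv h x = b" if x: "x \<in> ball 0 1" for x
  proof (cases "x = 0")
    case False
    define \<sigma> \<tau> where "\<sigma> = cmod x / 2" and "\<tau> = (1 + cmod x) / 2"
    have st: "0 < \<sigma>" "\<sigma> < cmod x" "cmod x < \<tau>" "\<tau> < 1"
      using False x by (auto simp: \<sigma>_def \<tau>_def)
    define U where "U = {v::real^2. \<sigma> < norm v \<and> norm v < \<tau>}"
    have "open U"
      unfolding U_def by (intro open_Collect_conj open_Collect_less continuous_intros)
    moreover have "plane x \<in> U"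
      using st by (simp add: U_def)
    ultimately obtain l u where lu: "cbox l u \<subseteq> U" "plane x \<in> box l u"
      by (rule open_contains_cbox)
    define g where "g = (\<lambda>v. (cmod (deriv h (cplx v) - b))\<^sup>2)"
    have sub: "cbox l u \<subseteq> annulus \<sigma> \<tau>"
      using lu(1) by (auto simp: U_def annulus_def)
    have cont: "continuous_on (cbox l u) g"
      unfolding g_def
    proof (intro continuous_intros continuous_on_compose2[OF holomorphic_on_imp_continuous_on[OF dh]]
        linear_continuous_on bounded_linear_cplx)
      show "cplx ` cbox l u \<subseteq> ball 0 1"
        using lu(1) st by (auto simp: U_def)
    qed
    have "integral (cbox l u) g \<le> Q \<sigma> \<tau>"
      unfolding Q_def g_def[symmetric]
      using int[OF st(4), of \<sigma>, folded g_def] sub integrable_continuous[OF cont]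
      by (intro integral_subset_le) (auto simp: g_def)
    moreover have "0 \<le> integral (cbox l u) g"
      by (rule Henstock_Kurzweil_Integration.integral_nonneg[OF integrable_continuous[OF cont]]) (simp add: g_def)
    moreover have "Q \<sigma> \<tau> \<le> 0"
      using st by (intro Q0) auto
    ultimately have "(g has_integral 0) (cbox l u)"
      using integrable_continuous[OF cont] by (simp add: has_integral_iff)
    then have "g (plane x) = 0"
      using cont lu(2) by (intro has_integral_0_cbox_imp_0[of l u g]) (auto simp: g_def subsetD[OF box_subset_cbox])
    then show ?thesis
      by (simp add: g_def)
  qed (simp add: b_def)
  have "\<exists>c. \<forall>x\<in>ball 0 1. h x - b * x = c"
  proof (rule has_field_derivative_zero_constant)
    fix x :: complex assume x: "x \<in> ball 0 1"
    have "(h has_field_derivative deriv h x) (at x)"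
      using h x by (intro holomorphic_derivI[of h "ball 0 1"]) auto
    then have "((\<lambda>x. h x - b * x) has_field_derivative 0) (at x)"
      unfolding dh_eq[OF x] by (auto intro!: derivative_eq_intros)
    then show "((\<lambda>x. h x - b * x) has_field_derivative 0) (at x within ball 0 1)"
      by (rule has_field_derivative_at_within)
  qed simp
  then obtain c where "\<And>x. x \<in> ball 0 1 \<Longrightarrow> h x - b * x = c"
    by blast
  from this[of 0] this[OF z] show "h z = h 0 + deriv h 0 * z"
    by (simp add: b_def algebra_simps)
qed


section \<open>Bieberbach's theorem\<close>

lemma one_plus_mult_nonzero:
  fixes b z :: complex
  assumes "cmod b = 1" "cmod z < 1"
  shows "1 + b * z \<noteq> 0"
proof
  assume "1 + b * z = 0"
  then have "cmod (b * z) = 1"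
    by (metis add_eq_0_iff norm_minus_cancel norm_one)
  then show False
    using assms by (simp add: norm_mult)
qed

text \<open>If \<open>m\<close> is an inverse square root of \<open>f z / z = 1 + z \<cdot> k z\<close>, then the first-order
  coefficients at 0 of the product \<open>(f z / z) (m z)\<^sup>2 = 1\<close> add up to 0.\<close>

lemma second_coefficient_eq:
  fixes k m :: "complex \<Rightarrow> complex"
  assumes k: "k holomorphic_on ball 0 1"
    and m: "(m has_field_derivative d) (at 0)" "m 0 = 1"
    and eq: "\<And>z. z \<in> ball 0 1 \<Longrightarrow> (1 + z * k z) * (m z)\<^sup>2 = 1"
  shows "k 0 = - 2 * d"
proof -
  have "(k has_field_derivative deriv k 0) (at 0)"
    using k by (intro holomorphic_derivI[of k "ball 0 1"]) auto
  then have "((\<lambda>z. (1 + z * k z) * (m z)\<^sup>2) has_field_derivative (k 0 + 2 * d)) (at 0)"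
    using m by (auto intro!: derivative_eq_intros)
  moreover have "((\<lambda>z. (1 + z * k z) * (m z)\<^sup>2) has_field_derivative 0) (at 0)"
    by (rule has_field_derivative_transform_within_open[OF DERIV_const[of 1] open_ball[of 0 1]])
      (use eq in auto)
  ultimately have "k 0 + 2 * d = 0"
    by (rule DERIV_unique)
  then show ?thesis
    by (simp add: eq_neg_iff_add_eq_0)
qed

text \<open>Here \<open>k 0\<close> is the second Taylor coefficient of \<open>f\<close>. The quotient \<open>f z / z\<close> has no zeros
  because \<open>f\<close> vanishes only at 0; let \<open>m\<close> be its holomorphic inverse square root with \<open>m 0 = 1\<close>. The map
  \<open>\<phi> z = m (z\<^sup>2) / z\<close> is the reciprocal of the odd square root transform \<open>sqrt (f (z\<^sup>2))\<close>. It inherits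
  injectivity: \<open>\<phi> x = \<phi> y\<close> forces \<open>f (x\<^sup>2) = f (y\<^sup>2)\<close> and hence \<open>x = \<plusminus> y\<close>, and the negative sign is
  excluded because \<open>\<phi>\<close> is odd without zeros. Since \<open>\<phi> z = 1/z - (k 0 / 2) z + \<dots>\<close>, the area theorem
  applies. In the extremal case \<open>\<phi> z = 1/z + b z\<close>, and solving for \<open>f\<close> gives a rotation of the Koebe
  function.\<close>

theorem bieberbach:
  fixes f k :: "complex \<Rightarrow> complex"
  assumes k: "k holomorphic_on ball 0 1"
    and f: "\<And>z. z \<in> ball 0 1 \<Longrightarrow> f z = z + z\<^sup>2 * k z"
    and inj: "inj_on f (ball 0 1)"
  shows "cmod (k 0) \<le> 2"
    and "cmod (k 0) = 2 \<longleftrightarrow> (\<exists>b. cmod b = 1 \<and> (\<forall>z\<in>ball 0 1. f z = z / (1 + b * z)\<^sup>2))"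
proof -
  define p where "p z = 1 + z * k z" for z
  have fp: "f z = z * p z" if "z \<in> ball 0 1" for z
    using f[OF that] by (simp add: p_def algebra_simps power2_eq_square)
  have p_nz: "p z \<noteq> 0" if z: "z \<in> ball 0 1" for z
  proof
    assume "p z = 0"
    then have "f z = f 0"
      using fp[OF z] fp[of 0] by simp
    then have "z = 0"
      using inj z by (auto dest: inj_onD)
    then show False
      using \<open>p z = 0\<close> by (simp add: p_def)
  qed
  have "p holomorphic_on ball 0 1"
    unfolding p_def by (intro holomorphic_intros k)
  then obtain r where r: "r holomorphic_on ball 0 1" "\<And>z. z \<in> ball 0 1 \<Longrightarrow> p z = (r z)\<^sup>2"
    using contractible_imp_holomorphic_sqrt[of p "ball 0 1"] p_nz convex_imp_contractible[OF convex_ball]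
    by blast
  have r_nz: "r z \<noteq> 0" if "z \<in> ball 0 1" for z
    using r(2)[OF that] p_nz[OF that] by auto
  \<comment> \<open>The square root is determined up to sign only; the factor \<open>r 0\<close>, which is 1 or -1, makes \<open>m 0 = 1\<close>.\<close>
  define m where "m z = r 0 / r z" for z
  have m: "m holomorphic_on ball 0 1" "m 0 = 1"
    unfolding m_def using r_nz by (auto intro!: holomorphic_intros r)
  have m_nz: "m z \<noteq> 0" if "z \<in> ball 0 1" for z
    using r_nz[OF that] r_nz[of 0] by (simp add: m_def)
  have pm: "p z * (m z)\<^sup>2 = 1" if "z \<in> ball 0 1" for z
  proof -
    have "(r 0)\<^sup>2 = 1"
      using r(2)[of 0] by (simp add: p_def)
    then show ?thesis
      using r(2)[OF that] r_nz[OF that] by (simp add: m_def power_divide)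
  qed
  define n where "n = (\<lambda>z. if z = 0 then deriv m 0 else (m z - m 0) / (z - 0))"
  have n: "n holomorphic_on ball 0 1"
    unfolding n_def by (intro pole_lemma_open m) simp
  have mn: "m z = 1 + z * n z" for z
    using m(2) by (simp add: n_def)
  have k0: "k 0 = - 2 * n 0"
    using pm k m by (intro second_coefficient_eq[of k m])
      (auto simp: n_def p_def intro: holomorphic_derivI)
  define h where "h z = z * n (z\<^sup>2)" for z
  have sq: "z\<^sup>2 \<in> ball 0 1" if "z \<in> ball 0 1" for z :: complex
    using that by (simp add: norm_power power_less_one_iff)
  have h: "h holomorphic_on ball 0 1" "h 0 = 0"
    unfolding h_def using sq
    by (auto intro!: holomorphic_intros holomorphic_on_compose_gen[OF _ n, unfolded o_def])
  have "deriv h 0 = n 0"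
  proof (rule DERIV_imp_deriv)
    have "(n has_field_derivative deriv n (0\<^sup>2)) (at (0\<^sup>2))"
      using n by (intro holomorphic_derivI[of n "ball 0 1"]) auto
    then show "(h has_field_derivative n 0) (at 0)"
      unfolding h_def by (auto intro!: derivative_eq_intros DERIV_chain2[of n])
  qed
  have \<phi>: "1 / z + h z = m (z\<^sup>2) / z" if "z \<noteq> 0" for z
    using that by (simp add: mn h_def field_simps power2_eq_square)
  have "inj_on (\<lambda>z. 1 / z + h z) (ball 0 1 - {0})"
  proof (rule inj_onI)
    fix x y :: complex
    assume x: "x \<in> ball 0 1 - {0}" and y: "y \<in> ball 0 1 - {0}" and "1 / x + h x = 1 / y + h y"
    then have eq: "m (x\<^sup>2) / x = m (y\<^sup>2) / y"
      by (simp add: \<phi>)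
    have f_sq: "f (z\<^sup>2) = 1 / (m (z\<^sup>2) / z)\<^sup>2" if "z \<in> ball 0 1 - {0}" for z
      using that fp[OF sq[of z]] pm[OF sq[of z]] m_nz[OF sq[of z]]
      by (simp add: field_simps)
    have "f (x\<^sup>2) = f (y\<^sup>2)"
      using f_sq[OF x] f_sq[OF y] eq by simp
    then have "x\<^sup>2 = y\<^sup>2"
      using inj sq x y by (auto dest: inj_onD)
    then show "x = y"
      using eq x y m_nz[OF sq[of y]] by (auto simp: power2_eq_iff field_simps)
  qed
  note area = area_theorem[OF h(1) this, unfolded \<open>deriv h 0 = n 0\<close>]
  show "cmod (k 0) \<le> 2"
    using area(1) by (simp add: k0 norm_mult)
  show "cmod (k 0) = 2 \<longleftrightarrow> (\<exists>b. cmod b = 1 \<and> (\<forall>z\<in>ball 0 1. f z = z / (1 + b * z)\<^sup>2))"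
  proof
    assume "cmod (k 0) = 2"
    then have n1: "cmod (n 0) = 1"
      by (simp add: k0 norm_mult)
    have "f w = w / (1 + n 0 * w)\<^sup>2" if w: "w \<in> ball 0 1" for w
    proof -
      have "m w = 1 + n 0 * w"
      proof (cases "w = 0")
        case False
        \<comment> \<open>Any square root of \<open>w\<close> turns the linearity of \<open>z \<cdot> n (z\<^sup>2)\<close> into the constancy of \<open>n\<close> at \<open>w\<close>.\<close>
        have "csqrt w \<in> ball 0 1"
          using w by (simp add: norm_csqrt)
        from area(2)[OF n1 this] False show ?thesis
          by (simp add: h_def mn)
      qed (simp add: m)
      then show ?thesis
        using fp[OF w] pm[OF w] m_nz[OF w] by (simp add: field_simps)
    qed
    with n1 show "\<exists>b. cmod b = 1 \<and> (\<forall>z\<in>ball 0 1. f z = z / (1 + b * z)\<^sup>2)"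
      by blast
  next
    assume "\<exists>b. cmod b = 1 \<and> (\<forall>z\<in>ball 0 1. f z = z / (1 + b * z)\<^sup>2)"
    then obtain b where b: "cmod b = 1" "\<And>z. z \<in> ball 0 1 \<Longrightarrow> f z = z / (1 + b * z)\<^sup>2"
      by blast
    have "k 0 = - 2 * b"
    proof (rule second_coefficient_eq[OF k])
      show "((\<lambda>z. 1 + b * z) has_field_derivative b) (at 0)"
        by (auto intro!: derivative_eq_intros)
      fix z :: complex assume z: "z \<in> ball 0 1"
      have "1 + b * z \<noteq> 0"
        using one_plus_mult_nonzero[OF b(1)] z by simp
      then have "z * ((1 + z * k z) * (1 + b * z)\<^sup>2) = z * 1"
        using b(2)[OF z] fp[OF z] by (simp add: p_def eq_divide_eq mult.assoc)
      then show "(1 + z * k z) * (1 + b * z)\<^sup>2 = 1"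
        by (cases "z = 0", simp) (metis mult_left_cancel)
    qed simp
    then show "cmod (k 0) = 2"
      using b(1) by (simp add: norm_mult)
  qed
qed

corollary bieberbach_series:
  fixes f :: "complex \<Rightarrow> complex" and a :: "nat \<Rightarrow> complex"
  assumes series: "\<And>z. z \<in> ball 0 1 \<Longrightarrow> (\<lambda>n. a (n + 2) * z ^ (n + 2)) sums (f z - z)"
    and inj: "inj_on f (ball 0 1)"
  shows "cmod (a 2) \<le> 2"
    and "cmod (a 2) = 2 \<longleftrightarrow> (\<exists>b. cmod b = 1 \<and> (\<forall>z\<in>ball 0 1. f z = z / (1 + b * z)\<^sup>2))"
proof -
  define k where "k z = (if z = 0 then a 2 else (f z - z) / z\<^sup>2)" for z
  have "(\<lambda>n. a (n + 2) * (z - 0) ^ n) sums k z" if z: "z \<in> ball 0 1" for z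
  proof (cases "z = 0")
    case True
    then show ?thesis
      using powser_sums_zero[of "\<lambda>n. a (n + 2)"] by (simp add: k_def numeral_2_eq_2)
  next
    case False
    have "(\<lambda>n. a (n + 2) * z ^ (n + 2) / z\<^sup>2) sums ((f z - z) / z\<^sup>2)"
      by (intro sums_divide series z)
    then show ?thesis
      using False by (simp add: k_def power2_eq_square)
  qed
  then have k: "k holomorphic_on ball 0 1"
    by (rule power_series_holomorphic)
  have f: "f z = z + z\<^sup>2 * k z" if "z \<in> ball 0 1" for z
    using sums_unique2[OF series[of 0]] by (auto simp: k_def)
  show "cmod (a 2) \<le> 2"
    "cmod (a 2) = 2 \<longleftrightarrow> (\<exists>b. cmod b = 1 \<and> (\<forall>z\<in>ball 0 1. f z = z / (1 + b * z)\<^sup>2))"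
    using bieberbach[OF k f inj] by (simp_all add: k_def)
qed


section \<open>Bicomplex functions by components\<close>

lemma bc_beta_arith:
  "bc_beta1 0 = 0" "bc_beta2 0 = 0" "bc_beta1 1 = 1" "bc_beta2 1 = 1"
  "bc_beta1 (Z + W) = bc_beta1 Z + bc_beta1 W" "bc_beta2 (Z + W) = bc_beta2 Z + bc_beta2 W"
  "bc_beta1 (Z - W) = bc_beta1 Z - bc_beta1 W" "bc_beta2 (Z - W) = bc_beta2 Z - bc_beta2 W"
  "bc_beta1 (Z * W) = bc_beta1 Z * bc_beta1 W" "bc_beta2 (Z * W) = bc_beta2 Z * bc_beta2 W"
  by (simp_all add: bc_beta1_def bc_beta2_def algebra_simps)

lemma bc_beta_power:
  "bc_beta1 (Z ^ n) = bc_beta1 Z ^ n" "bc_beta2 (Z ^ n) = bc_beta2 Z ^ n"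
  by (induction n) (simp_all add: bc_beta_arith)

lemma bc_eq_iff_beta: "Z = W \<longleftrightarrow> bc_beta1 Z = bc_beta1 W \<and> bc_beta2 Z = bc_beta2 W"
  by (metis bc_idem_beta)

lemma bc_beta_divide:
  assumes "bc_beta1 W \<noteq> 0" "bc_beta2 W \<noteq> 0"
  shows "bc_beta1 (Z / W) = bc_beta1 Z / bc_beta1 W" "bc_beta2 (Z / W) = bc_beta2 Z / bc_beta2 W"
proof -
  have "W * inverse W = 1"
    using assms by (intro bc_right_inverse) (simp add: bc_zero_divisors0_iff)
  then have "bc_beta1 W * bc_beta1 (inverse W) = 1" "bc_beta2 W * bc_beta2 (inverse W) = 1"
    by (simp_all add: bc_eq_iff_beta[of "W * inverse W"] bc_beta_arith)
  then show "bc_beta1 (Z / W) = bc_beta1 Z / bc_beta1 W" "bc_beta2 (Z / W) = bc_beta2 Z / bc_beta2 W"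
    using assms by (simp_all add: divide_bicomplex_def bc_beta_arith field_simps)
qed

lemma bounded_linear_bc_beta: "bounded_linear bc_beta1" "bounded_linear bc_beta2"
proof -
  have "cmod (cpt1 Z) \<le> norm Z * 1" "cmod (cpt2 Z) \<le> norm Z * 1" for Z
    by (simp_all add: norm_bicomplex_def)
  then have "bounded_linear cpt1" "bounded_linear cpt2"
    by (auto intro!: bounded_linear_intro[where K = 1])
  then show "bounded_linear bc_beta1" "bounded_linear bc_beta2"
    unfolding bc_beta1_def[abs_def] bc_beta2_def[abs_def]
    by (auto intro!: bounded_linear_intros bounded_linear_compose[OF bounded_linear_mult_right])
qed

lemma bc_hnorm_eq_of_real_iff:
  "bc_hnorm Z = of_real c \<longleftrightarrow> cmod (bc_beta1 Z) = c \<and> cmod (bc_beta2 Z) = c"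
  by (simp add: bc_hnorm_def of_real_bc_idem bc_eq_iff_beta[of "bc_idem _ _"])

text \<open>A collision \<open>F1 x = F1 y\<close> makes \<open>F\<close> collide at the points with first components \<open>x\<close> and
  \<open>y\<close> and second component 0, so univalence passes to each component. The factors of a nonempty
  product set are determined by the set, which is why the components are defined on the whole unit
  disk.\<close>

lemma bc_univalent_components:
  assumes "bc_univalent_on F bc_disk"
  obtains F1 F2 where
    "\<And>b1 b2. b1 \<in> ball 0 1 \<Longrightarrow> b2 \<in> ball 0 1 \<Longrightarrow> F (bc_idem b1 b2) = bc_idem (F1 b1) (F2 b2)"
    "inj_on F1 (ball 0 1)" "inj_on F2 (ball 0 1)"
proof -
  have "bc_product_type_fun bc_disk F"
    using assms by (simp add: bc_univalent_on_def)
  then obtain \<Omega>1 \<Omega>2 F1 F2 where \<Omega>: "bc_disk = bc_product_set \<Omega>1 \<Omega>2"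
    and F: "\<forall>b1\<in>\<Omega>1. \<forall>b2\<in>\<Omega>2. F (bc_idem b1 b2) = bc_idem (F1 b1) (F2 b2)"
    unfolding bc_product_type_fun_def by (elim exE conjE) (erule that)
  have disk: "bc_idem b1 b2 \<in> bc_disk" if "b1 \<in> ball 0 1" "b2 \<in> ball 0 1" for b1 b2
    using that by (auto simp: bc_disk_def)
  have sub: "b1 \<in> \<Omega>1 \<and> b2 \<in> \<Omega>2" if "b1 \<in> ball 0 1" "b2 \<in> ball 0 1" for b1 b2
    using disk[OF that] unfolding \<Omega> bc_product_set_def by (auto simp: bc_eq_iff_beta)
  have F': "F (bc_idem b1 b2) = bc_idem (F1 b1) (F2 b2)" if "b1 \<in> ball 0 1" "b2 \<in> ball 0 1" for b1 b2
    using F sub[OF that] by blast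
  have inj: "Z = W" if "Z \<in> bc_disk" "W \<in> bc_disk" "F Z = F W" for Z W
    using assms that unfolding bc_univalent_on_def by blast
  have "inj_on F1 (ball 0 1)"
  proof (rule inj_onI)
    fix x y assume xy: "x \<in> ball 0 1" "y \<in> ball 0 1" "F1 x = F1 y"
    have "bc_idem x 0 = bc_idem y 0"
      by (rule inj[OF disk disk]) (use xy in \<open>auto simp: F'\<close>)
    then show "x = y"
      by (metis bc_beta_idem(1))
  qed
  moreover have "inj_on F2 (ball 0 1)"
  proof (rule inj_onI)
    fix x y assume xy: "x \<in> ball 0 1" "y \<in> ball 0 1" "F2 x = F2 y"
    have "bc_idem 0 x = bc_idem 0 y"
      by (rule inj[OF disk disk]) (use xy in \<open>auto simp: F'\<close>)
    then show "x = y"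
      by (metis bc_beta_idem(2))
  qed
  ultimately show ?thesis
    using that F' by blast
qed

lemma bc_koebe_beta:
  assumes "cmod (bc_beta1 B) = 1" "cmod (bc_beta2 B) = 1" "Z \<in> bc_disk"
  shows "bc_beta1 (Z / (1 + B * Z)\<^sup>2) = bc_beta1 Z / (1 + bc_beta1 B * bc_beta1 Z)\<^sup>2"
    and "bc_beta2 (Z / (1 + B * Z)\<^sup>2) = bc_beta2 Z / (1 + bc_beta2 B * bc_beta2 Z)\<^sup>2"
proof -
  have "cmod (bc_beta1 Z) < 1" "cmod (bc_beta2 Z) < 1"
    using assms(3) by (auto simp: bc_disk_def)
  then show "bc_beta1 (Z / (1 + B * Z)\<^sup>2) = bc_beta1 Z / (1 + bc_beta1 B * bc_beta1 Z)\<^sup>2"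
    and "bc_beta2 (Z / (1 + B * Z)\<^sup>2) = bc_beta2 Z / (1 + bc_beta2 B * bc_beta2 Z)\<^sup>2"
    using assms one_plus_mult_nonzero by (simp_all add: bc_beta_divide bc_beta_power bc_beta_arith)
qed

text \<open>The rotation parameter \<open>B\<close> has hyperbolic norm 1 exactly when both of its components lie on
  the unit circle, and the two components can be chosen independently of each other.\<close>

lemma bc_koebe_rotation_iff_components:
  assumes F: "\<And>b1 b2. b1 \<in> ball 0 1 \<Longrightarrow> b2 \<in> ball 0 1 \<Longrightarrow> F (bc_idem b1 b2) = bc_idem (F1 b1) (F2 b2)"
  shows "bc_koebe_rotation F \<longleftrightarrow>
    (\<exists>b. cmod b = 1 \<and> (\<forall>z\<in>ball 0 1. F1 z = z / (1 + b * z)\<^sup>2)) \<and>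
    (\<exists>b. cmod b = 1 \<and> (\<forall>z\<in>ball 0 1. F2 z = z / (1 + b * z)\<^sup>2))"
proof
  assume "bc_koebe_rotation F"
  then obtain B where "bc_hnorm B = of_real 1" and FB: "\<And>Z. Z \<in> bc_disk \<Longrightarrow> F Z = Z / (1 + B * Z)\<^sup>2"
    unfolding bc_koebe_rotation_def by auto
  then have B: "cmod (bc_beta1 B) = 1" "cmod (bc_beta2 B) = 1"
    by (simp_all only: bc_hnorm_eq_of_real_iff)
  have "F1 z = z / (1 + bc_beta1 B * z)\<^sup>2 \<and> F2 z = z / (1 + bc_beta2 B * z)\<^sup>2" if "z \<in> ball 0 1" for z
  proof -
    have "bc_idem z z \<in> bc_disk"
      using that by (auto simp: bc_disk_def)
    from bc_koebe_beta[OF B this] FB[OF this] show ?thesis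
      using F[OF that that] by (simp add: bc_eq_iff_beta)
  qed
  with B show "(\<exists>b. cmod b = 1 \<and> (\<forall>z\<in>ball 0 1. F1 z = z / (1 + b * z)\<^sup>2)) \<and>
      (\<exists>b. cmod b = 1 \<and> (\<forall>z\<in>ball 0 1. F2 z = z / (1 + b * z)\<^sup>2))"
    by blast
next
  assume "(\<exists>b. cmod b = 1 \<and> (\<forall>z\<in>ball 0 1. F1 z = z / (1 + b * z)\<^sup>2)) \<and>
      (\<exists>b. cmod b = 1 \<and> (\<forall>z\<in>ball 0 1. F2 z = z / (1 + b * z)\<^sup>2))"
  then obtain b1 b2 where b: "cmod b1 = 1" "cmod b2 = 1"
    and F12: "\<And>z. z \<in> ball 0 1 \<Longrightarrow> F1 z = z / (1 + b1 * z)\<^sup>2"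
      "\<And>z. z \<in> ball 0 1 \<Longrightarrow> F2 z = z / (1 + b2 * z)\<^sup>2"
    by blast
  define B where "B = bc_idem b1 b2"
  have "bc_hnorm B = of_real 1"
    unfolding bc_hnorm_eq_of_real_iff by (simp add: B_def b)
  moreover have "F Z = Z / (1 + B * Z)\<^sup>2" if Z: "Z \<in> bc_disk" for Z
  proof -
    have disk: "bc_beta1 Z \<in> ball 0 1" "bc_beta2 Z \<in> ball 0 1"
      using Z by (auto simp: bc_disk_def)
    then have "F Z = bc_idem (F1 (bc_beta1 Z)) (F2 (bc_beta2 Z))"
      using F[OF disk] by simp
    then show ?thesis
      using disk Z b by (simp add: bc_eq_iff_beta[of _ "Z / _"] bc_koebe_beta F12 B_def)
  qed
  ultimately show "bc_koebe_rotation F"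
    unfolding bc_koebe_rotation_def by auto
qed

theorem theorem2p6:
  fixes F :: "bicomplex \<Rightarrow> bicomplex" and A :: "nat \<Rightarrow> bicomplex"
  assumes "F \<in> bc_class_F"
    and "\<And>Z. Z \<in> bc_disk \<Longrightarrow> (\<lambda>n. A (n + 2) * Z ^ (n + 2)) sums (F Z - Z)"
  shows "hyp_le (bc_hnorm (A 2)) 2 \<and> (bc_hnorm (A 2) = 2 \<longleftrightarrow> bc_koebe_rotation F)"
proof -
  have "bc_univalent_on F bc_disk"
    using assms(1) by (simp add: bc_class_F_def)
  then obtain F1 F2 where
    F: "\<And>b1 b2. b1 \<in> ball 0 1 \<Longrightarrow> b2 \<in> ball 0 1 \<Longrightarrow> F (bc_idem b1 b2) = bc_idem (F1 b1) (F2 b2)"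
    and inj: "inj_on F1 (ball 0 1)" "inj_on F2 (ball 0 1)"
    using bc_univalent_components[of F] by blast
  have "(\<lambda>n. bc_beta1 (A (n + 2)) * z ^ (n + 2)) sums (F1 z - z)"
    "(\<lambda>n. bc_beta2 (A (n + 2)) * z ^ (n + 2)) sums (F2 z - z)" if z: "z \<in> ball 0 1" for z
  proof -
    \<comment> \<open>The diagonal point carries \<open>z\<close> in both components, so one expansion yields both scalar ones.\<close>
    have "bc_idem z z \<in> bc_disk"
      using z by (auto simp: bc_disk_def)
    note series = assms(2)[OF this]
    show "(\<lambda>n. bc_beta1 (A (n + 2)) * z ^ (n + 2)) sums (F1 z - z)"
      using bounded_linear.sums[OF bounded_linear_bc_beta(1) series]
      by (simp add: F[OF z z] bc_beta_arith(5-) bc_beta_power del: power_Suc)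
    show "(\<lambda>n. bc_beta2 (A (n + 2)) * z ^ (n + 2)) sums (F2 z - z)"
      using bounded_linear.sums[OF bounded_linear_bc_beta(2) series]
      by (simp add: F[OF z z] bc_beta_arith(5-) bc_beta_power del: power_Suc)
  qed
  note component1 = bieberbach_series[OF this(1) inj(1)] and component2 = bieberbach_series[OF this(2) inj(2)]
  have two: "(2 :: bicomplex) = of_real 2"
    by simp
  have "hyp_le (bc_hnorm (A 2)) 2"
    unfolding hyp_le_def two of_real_bc_idem bc_hnorm_def using component1(1) component2(1) by blast
  moreover have "bc_koebe_rotation F \<longleftrightarrow>
      (\<exists>b. cmod b = 1 \<and> (\<forall>z\<in>ball 0 1. F1 z = z / (1 + b * z)\<^sup>2)) \<and>
      (\<exists>b. cmod b = 1 \<and> (\<forall>z\<in>ball 0 1. F2 z = z / (1 + b * z)\<^sup>2))"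
    using F by (rule bc_koebe_rotation_iff_components)
  then have "bc_hnorm (A 2) = 2 \<longleftrightarrow> bc_koebe_rotation F"
    unfolding two bc_hnorm_eq_of_real_iff using component1(2) component2(2) by simp
  ultimately show ?thesis ..
qed

end
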